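(* Let $X_N=\{\mathbf{x}_1,\dots,\mathbf{x}_N\}\subseteq\mathbb{S}^2$ be a set of $N\ge 2$ distinct points with mesh norm $h_{X_N}$ and separation distance $q_{X_N}$, and suppose $0<h_{X_N}\le 2$. Define $L:=\lceil 55/q_{X_N}\rceil$ and $H:=\lfloor 2/h_{X_N}\rfloor$. For $s>1$, the condition number of the discrepancy matrix $\mathbf{K}_s$ of $X_N$ satisfies $$\frac{q_{X_N}^3(s-1)}{8\pi^2}\left(\frac{2H+1}{9}\right)^s\le \mathrm{cond}(\mathbf{K}_s)\le \frac{8\pi^2}{q_{X_N}^2(s-1)}(2L+1)^{2s}.$$
   Context: $\mathbb{S}^2$ is the unit sphere in $\mathbb{R}^3$ and $\mathrm{dist}(\mathbf{x},\mathbf{y})=\arccos\langle\mathbf{x},\mathbf{y}\rangle$ is the geodesic distance. The mesh norm is $h_{X_N}:=\max_{\mathbf{x}\in\mathbb{S}^2}\min_{\mathbf{x}_j\in X_N}\mathrm{dist}(\mathbf{x},\mathbf{x}_j)$ and the separation distance is $q_{X_N}:=\min_{i\ne j}\mathrm{dist}(\mathbf{x}_i,\mathbf{x}_j)$. $P_\ell$ is the Legendre polynomial of degree $\ell$ normalized by $P_\ell(1)=1$. For $s>1$ put $a_\ell^{(s)}:=(\ell+\tfrac12)^{-2s}$ and $$K_s'(\mathbf{x},\mathbf{y}):=\sum_{\ell=1}^\infty\frac{2\ell+1}{4\pi}a_\ell^{(s)}P_\ell(\langle\mathbf{x},\mathbf{y}\rangle),\qquad \mathbf{x},\mathbf{y}\in\mathbb{S}^2.$$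 The discrepancy matrix is $\mathbf{K}_s:=[K_s'(\mathbf{x}_i,\mathbf{x}_j)]_{i,j=1}^N$, a real symmetric positive definite matrix with eigenvalues $0<\lambda_1\le\dots\le\lambda_N$; its condition number is $\mathrm{cond}(\mathbf{K}_s):=\lambda_N/\lambda_1$. *)

theory Defs
  imports
    "HOL-Analysis.Analysis"
    "HOL-Computational_Algebra.Polynomial"
    "Jordan_Normal_Form.Matrix"
    "Jordan_Normal_Form.Spectral_Radius"
begin

text \<open>
  The Legendre polynomials, introduced by Rodrigues' formula. The three lemmas after the
  definition give the characterization: exact degree n, value 1 at 1, and orthogonality on [-1,1]
  to all polynomials of smaller degree.
\<close>

definition legendre :: "nat \<Rightarrow> real poly" where
  "legendre n = Polynomial.smult (1 / (2 ^ n * fact n)) ((pderiv ^^ n) ([:-1, 0, 1:] ^ n))"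

lemma poly_pderiv_funpow_at_root:
  fixes a :: real
  shows "poly ((pderiv ^^ n) ([:-a, 1:] ^ n * q)) a = fact n * poly q a"
proof (induction n arbitrary: q)
  case (Suc n)
  have "pderiv ([:-a, 1:] ^ Suc n * q)
      = [:-a, 1:] ^ n * (Polynomial.smult (of_nat (Suc n)) q + [:-a, 1:] * pderiv q)"
    by (simp only: pderiv_mult pderiv_power_Suc pderiv_pCons pderiv_0)
       (simp add: algebra_simps)
  then show ?case
    unfolding funpow_Suc_right o_def
    by (simp only: Suc.IH) (simp add: algebra_simps)
qed simp

lemma legendre_base_eq: "[:-1, 0, 1:] ^ n = [:-1, 1:] ^ n * ([:1, 1:] ^ n :: real poly)"
proof -
  have "[:-1, 0, 1:] = [:-1, 1:] * ([:1, 1:] :: real poly)" by simp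
  then show ?thesis by (metis power_mult_distrib)
qed

lemma legendre_at_1: "poly (legendre n) 1 = 1"
  using poly_pderiv_funpow_at_root[of n 1 "[:1, 1:] ^ n"]
  by (simp add: legendre_def legendre_base_eq)

lemma degree_legendre: "degree (legendre n) = n"
proof -
  have "degree ((pderiv ^^ k) p) = degree p - k" for k and p :: "real poly"
    by (induction k) (auto simp: degree_pderiv)
  moreover have "degree ([:-1, 0, 1:] ^ n :: real poly) = 2 * n"
    by (simp add: degree_power_eq)
  ultimately show ?thesis by (simp add: legendre_def)
qed

lemma linear_power_dvd_pderiv_funpow:
  fixes p :: "real poly"
  assumes "[:-a, 1:] ^ m dvd p" and "k \<le> m"
  shows "[:-a, 1:] ^ (m - k) dvd (pderiv ^^ k) p"
  using assms(2)
proof (induction k)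
  case 0
  then show ?case using assms(1) by simp
next
  case (Suc k)
  then obtain r where r: "(pderiv ^^ k) p = [:-a, 1:] ^ Suc (m - Suc k) * r"
    by (metis Suc_diff_Suc Suc_le_lessD dvdE less_imp_le)
  have "pderiv ((pderiv ^^ k) p) = [:-a, 1:] ^ (m - Suc k)
      * (Polynomial.smult (of_nat (Suc (m - Suc k))) r + [:-a, 1:] * pderiv r)"
    unfolding r
    by (simp only: pderiv_mult pderiv_power_Suc pderiv_pCons pderiv_0)
       (simp add: algebra_simps)
  then show ?case by simp
qed

lemma legendre_base_boundary:
  assumes "k < n"
  shows "poly ((pderiv ^^ k) ([:-1, 0, 1:] ^ n)) (1::real) = 0"
    and "poly ((pderiv ^^ k) ([:-1, 0, 1:] ^ n)) (-1::real) = 0"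
proof -
  have "poly ((pderiv ^^ k) ([:-1, 0, 1:] ^ n)) a = 0"
    if "[:-a, 1:] ^ n dvd [:-1, 0, 1:] ^ n" for a :: real
  proof -
    have "[:-a, 1:] dvd [:-a, 1:] ^ (n - k)" using assms by (simp add: dvd_power)
    also have "\<dots> dvd (pderiv ^^ k) ([:-1, 0, 1:] ^ n)"
      using linear_power_dvd_pderiv_funpow[OF that, of k] assms by simp
    finally show ?thesis by (simp add: poly_eq_0_iff_dvd)
  qed
  then show "poly ((pderiv ^^ k) ([:-1, 0, 1:] ^ n)) (1::real) = 0"
    and "poly ((pderiv ^^ k) ([:-1, 0, 1:] ^ n)) (-1::real) = 0"
    by (simp_all add: legendre_base_eq)
qed

lemma legendre_orthogonal:
  assumes "degree q < n"
  shows "((\<lambda>t. poly (legendre n) t * poly q t) has_integral 0) {-1..1}"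
proof -
  let ?p = "[:-1, 0, 1:] ^ n :: real poly"
  have *: "((\<lambda>t. poly ((pderiv ^^ k) ?p) t * poly q t) has_integral 0) {-1..1}"
    if "k \<le> n" "q = 0 \<or> degree q < k" for k and q :: "real poly"
    using that
  proof (induction k arbitrary: q)
    case (Suc k)
    let ?w = "(pderiv ^^ k) ?p"
    have 1: "((\<lambda>t. poly (pderiv (?w * q)) t) has_integral 0) {-1..1}"
    proof -
      have "((\<lambda>t. poly (pderiv (?w * q)) t) has_integral
              (poly (?w * q) 1 - poly (?w * q) (-1))) {-1..1}"
      proof (rule fundamental_theorem_of_calculus)
        fix t :: real
        show "(poly (?w * q) has_vector_derivative poly (pderiv (?w * q)) t) (at t within {-1..1})"
          unfolding has_real_derivative_iff_has_vector_derivative[symmetric]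
          by (rule DERIV_subset[OF poly_DERIV]) simp
      qed simp
      then show ?thesis using Suc.prems(1) legendre_base_boundary[of k n] by simp
    qed
    have "pderiv q = 0 \<or> degree (pderiv q) < k"
      using Suc.prems(2) by (auto simp: degree_pderiv pderiv_eq_0_iff)
    then have 2: "((\<lambda>t. poly ?w t * poly (pderiv q) t) has_integral 0) {-1..1}"
      using Suc.IH[of "pderiv q"] Suc.prems(1) by simp
    show ?case
      using has_integral_diff[OF 1 2] by (simp add: pderiv_mult algebra_simps)
  qed simp
  show ?thesis
    using has_integral_mult_right[OF *[of n q], of "1 / (2 ^ n * fact n)"] assms
    by (simp add: legendre_def)
qed

definition geo_dist :: "real^3 \<Rightarrow> real^3 \<Rightarrow> real" where
  "geo_dist x y = arccos (inner x y)"

text \<open>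
  For finite nonempty X the supremum is attained, since the minimum depends continuously on x and
  the sphere is compact.
\<close>

definition mesh_norm :: "(real^3) set \<Rightarrow> real" where
  "mesh_norm X = (SUP x\<in>sphere 0 1. MIN y\<in>X. geo_dist x y)"

definition separation_dist :: "(real^3) set \<Rightarrow> real" where
  "separation_dist X = Min {geo_dist x y | x y. x \<in> X \<and> y \<in> X \<and> x \<noteq> y}"

definition kernel_coeff :: "real \<Rightarrow> nat \<Rightarrow> real" where
  "kernel_coeff s l = (real l + 1/2) powr (- 2 * s)"

text \<open>The sum starts at degree 1, hence the index shift.\<close>

definition discrepancy_kernel :: "real \<Rightarrow> real^3 \<Rightarrow> real^3 \<Rightarrow> real" where
  "discrepancy_kernel s x y =
     (\<Sum>k. let l = Suc k in
        (2 * real l + 1) / (4 * pi) * kernel_coeff s l * poly (legendre l) (inner x y))"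

definition discrepancy_matrix :: "real \<Rightarrow> nat \<Rightarrow> (nat \<Rightarrow> real^3) \<Rightarrow> real Matrix.mat" where
  "discrepancy_matrix s N x = Matrix.mat N N (\<lambda>(i, j). discrepancy_kernel s (x i) (x j))"

text \<open>
  Largest over smallest eigenvalue; meant for real symmetric positive definite matrices only.
\<close>

definition cond_number :: "real Matrix.mat \<Rightarrow> real" where
  "cond_number A = Max (spectrum A) / Min (spectrum A)"

end

theory Submission
  imports Defs
begin

text \<open>
  The matrix is a positive combination of the Gram matrices of the Legendre kernels
  \<open>P\<^sub>l \<langle>x, y\<rangle>\<close>, which by the addition theorem are positive semidefinite of rank at most
  \<open>2 l + 1\<close>. The addition theorem is proved by observing that the right-hand side is invariant under
  rotations about two axes, so that one of the points may be moved to the pole.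

  Upper bounds for the quadratic form come from \<open>\<bar>P\<^sub>l\<bar> \<le> 1\<close> and the midpoint rule for the coefficient sum.
  For the smallest eigenvalue from below, the form is compared with the one of the squared Fejer kernel of
  degree at most \<open>L\<close>, which is diagonally dominant at \<open>q\<close>-separated points. From above, some vector
  annihilates all polynomials of degree less than \<open>H\<close>, because \<open>H\<^sup>2 < N\<close>. The packing bound
  \<open>N q\<^sup>2 \<le> 4 \<pi>\<^sup>2\<close> and the covering bound \<open>4 < N h\<^sup>2\<close> follow by averaging zonal functions over the
  sphere; for polynomials the average reduces, again by the addition theorem, to finitely many points on each
  circle of latitude and an integral over the height.
\<close>

section \<open>The addition theorem for Legendre polynomials\<close>

text \<open>The absence of degree 0 from \<open>discrepancy_kernel\<close> is the obstacle in the
  lower bound for the smallest eigenvalue: the constant part of the squared Fejer kernel has to be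
  subtracted, which costs up to \<open>4 * m^2 * N\<close> against a diagonal of \<open>m^4\<close>.
  This is affordable because the packing bound makes \<open>N\<close> at most a multiple of
  \<open>1 / q^2\<close>, and \<open>m\<close> is about \<open>L / 2\<close>. The constant 55 makes
  \<open>(m * q)^2\<close> at least 756, enough to outweigh the off-diagonal row sums, the constant
  part and a final factor \<open>4 * m^2\<close> together. On the other side the 9 stems from the
  weight of degree 1, which bounds a diagonal entry from below: it contributes
  \<open>(3/2) powr (- 2 * s) = (4/9) powr s\<close>, while the annihilating vector contributes
  \<open>(H^2) powr s\<close>. Its existence rests on the strict inequality \<open>H^2 < N\<close>,
  and the strictness comes from \<open>sin x < x\<close> in the covering bound.\<close>

lemma poly_ext: "(\<And>t. poly p t = poly q t) \<Longrightarrow> p = (q :: real poly)"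
  by (simp add: poly_eq_poly_eq_iff[symmetric] ext)

text \<open>Differentiating \<open>(t^2 - 1) u' = 2 n t u\<close> once gives the case
  \<open>k = 0\<close>, each further derivative the next \<open>k\<close>. At
  \<open>k = n + m\<close> it becomes the equation of the \<open>m\<close>-th derivative of the
  Legendre polynomial.\<close>

lemma rodrigues_base_ode:
  fixes n k :: nat
  defines "u \<equiv> [:-1, 0, 1:] ^ n :: real poly"
  shows "[:-1, 0, 1:] * (pderiv ^^ (k + 2)) u
           + Polynomial.smult (2 * (real k + 1 - real n)) ([:0, 1:] * (pderiv ^^ (k + 1)) u)
           + Polynomial.smult ((real k + 1) * (real k - 2 * real n)) ((pderiv ^^ k) u) = 0"
proof (induction k)
  case 0
  have "[:-1, 0, 1:] * pderiv u = Polynomial.smult (2 * real n) ([:0, 1:] * u)"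
  proof (cases n)
    case (Suc m)
    then show ?thesis
      unfolding u_def
      by (simp only: pderiv_power_Suc) (simp add: pderiv_pCons algebra_simps)
  qed (simp add: u_def)
  then have "pderiv ([:-1, 0, 1:] * pderiv u) = pderiv (Polynomial.smult (2 * real n) ([:0, 1:] * u))"
    by simp
  then have eq: "poly (pderiv ([:-1, 0, 1:] * pderiv u)) t
      = poly (pderiv (Polynomial.smult (2 * real n) ([:0, 1:] * u))) t" for t by simp
  show ?case
  proof (rule poly_ext)
    fix t show "poly ([:-1, 0, 1:] * (pderiv ^^ (0 + 2)) u
           + Polynomial.smult (2 * (real 0 + 1 - real n)) ([:0, 1:] * (pderiv ^^ (0 + 1)) u)
           + Polynomial.smult ((real 0 + 1) * (real 0 - 2 * real n)) ((pderiv ^^ 0) u)) t = poly 0 t"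
      using eq[of t] by (simp add: pderiv_mult pderiv_smult pderiv_pCons pderiv_diff numeral_2_eq_2 algebra_simps)
  qed
next
  case (Suc k)
  let ?w = "\<lambda>j. (pderiv ^^ j) u"
  have "pderiv ([:-1, 0, 1:] * ?w (k + 2)
           + Polynomial.smult (2 * (real k + 1 - real n)) ([:0, 1:] * ?w (k + 1))
           + Polynomial.smult ((real k + 1) * (real k - 2 * real n)) (?w k)) = 0"
    using Suc by simp
  then have eq: "poly (pderiv ([:-1, 0, 1:] * ?w (k + 2)
           + Polynomial.smult (2 * (real k + 1 - real n)) ([:0, 1:] * ?w (k + 1))
           + Polynomial.smult ((real k + 1) * (real k - 2 * real n)) (?w k))) t = 0" for t by simp
  show ?case
  proof (rule poly_ext)
    fix t show "poly ([:-1, 0, 1:] * ?w (Suc k + 2)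
           + Polynomial.smult (2 * (real (Suc k) + 1 - real n)) ([:0, 1:] * ?w (Suc k + 1))
           + Polynomial.smult ((real (Suc k) + 1) * (real (Suc k) - 2 * real n)) (?w (Suc k))) t = poly 0 t"
      using eq[of t]
      by (simp add: pderiv_mult pderiv_smult pderiv_add pderiv_pCons pderiv_diff numeral_2_eq_2 algebra_simps)
  qed
qed

definition legendre_deriv :: "nat \<Rightarrow> nat \<Rightarrow> real \<Rightarrow> real" where
  "legendre_deriv l m t = poly ((pderiv ^^ m) (legendre l)) t"

lemma legendre_deriv_0: "legendre_deriv l 0 t = poly (legendre l) t"
  by (simp add: legendre_deriv_def)

lemma legendre_deriv_eq_0: "l < m \<Longrightarrow> legendre_deriv l m t = 0"
proof -
  have *: "degree ((pderiv ^^ k) (legendre l)) = l - k" for k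
    by (induction k) (auto simp: degree_pderiv degree_legendre)
  assume "l < m"
  then obtain k where m: "m = Suc (l + k)" using less_iff_Suc_add by auto
  have "pderiv ((pderiv ^^ (l + k)) (legendre l)) = 0"
    using *[of "l + k"] by (simp add: pderiv_eq_0_iff)
  then show ?thesis by (simp add: legendre_deriv_def m)
qed

lemma DERIV_legendre_deriv:
  assumes "(h has_real_derivative d) (at u)"
  shows "((\<lambda>u. legendre_deriv l m (h u)) has_real_derivative legendre_deriv l (Suc m) (h u) * d) (at u)"
  unfolding legendre_deriv_def
  using DERIV_chain2[OF poly_DERIV assms] by simp

text \<open>By Rodrigues' formula this is the equation of \<open>(t^2 - 1)^l\<close> for the
  derivative of order \<open>l + m\<close>, which explains the factors \<open>l + m + 1\<close> and
  \<open>l - m\<close>. It serves to eliminate the derivative of order \<open>m + 2\<close> where it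
  occurs multiplied by \<open>1 - t^2\<close>.\<close>

lemma legendre_deriv_ode:
  "(1 - t\<^sup>2) * legendre_deriv l (m + 2) t
     = 2 * (real m + 1) * t * legendre_deriv l (m + 1) t
       - (real l + real m + 1) * (real l - real m) * legendre_deriv l m t"
proof -
  define u :: "real poly" where "u = [:-1, 0, 1:] ^ l"
  define c :: real where "c = 1 / (2 ^ l * fact l)"
  have smult: "(pderiv ^^ j) (Polynomial.smult c p) = Polynomial.smult c ((pderiv ^^ j) p)" for j p
    by (induction j) (auto simp: pderiv_smult)
  have P: "legendre_deriv l j t = c * poly ((pderiv ^^ (l + j)) u) t" for j
    by (simp add: legendre_deriv_def legendre_def smult funpow_add[symmetric] add.commute
        flip: u_def c_def funpow_add comp_def) (metis add.commute comp_apply funpow_add)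
  have "poly ([:-1, 0, 1:] * (pderiv ^^ (l + m + 2)) u
           + Polynomial.smult (2 * (real (l + m) + 1 - real l)) ([:0, 1:] * (pderiv ^^ (l + m + 1)) u)
           + Polynomial.smult ((real (l + m) + 1) * (real (l + m) - 2 * real l)) ((pderiv ^^ (l + m)) u)) t = 0"
    unfolding u_def rodrigues_base_ode by simp
  then have "c * ((t\<^sup>2 - 1) * poly ((pderiv ^^ (l + (m + 2))) u) t
      + 2 * (real m + 1) * t * poly ((pderiv ^^ (l + (m + 1))) u) t
      + (real l + real m + 1) * (real m - real l) * poly ((pderiv ^^ (l + m)) u) t) = 0"
    by (simp add: algebra_simps power2_eq_square)
  then show ?thesis unfolding P by (simp add: algebra_simps)
qed

text \<open>The spherical harmonic of degree \<open>l\<close> and order \<open>m\<close>, up to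
  normalization, at the point with horizontal part \<open>z\<close> and height \<open>t\<close>. On
  the sphere \<open>z ^ m\<close> is the factor \<open>(1 - t^2)^(m/2)\<close> of the associated
  Legendre function times the phase, so neither square roots nor angles occur.\<close>

definition sph_harm :: "nat \<Rightarrow> nat \<Rightarrow> complex \<Rightarrow> real \<Rightarrow> complex" where
  "sph_harm l m z t = z ^ m * of_real (legendre_deriv l m t)"

definition fact_ratio :: "nat \<Rightarrow> nat \<Rightarrow> real" where
  "fact_ratio l m = fact (l - m) / fact (l + m)"

text \<open>The factor 2 accounts for the orders \<open>m\<close> and \<open>-m\<close> at once:
  they contribute conjugate terms, and \<open>sph_kernel\<close> takes the real part.\<close>

definition sph_weight :: "nat \<Rightarrow> nat \<Rightarrow> real" where
  "sph_weight l m = (if m = 0 then 1 else 2 * fact_ratio l m)"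

definition sph_kernel :: "nat \<Rightarrow> complex \<Rightarrow> real \<Rightarrow> complex \<Rightarrow> real \<Rightarrow> real" where
  "sph_kernel l z t w s = (\<Sum>m\<le>l. sph_weight l m * Re (sph_harm l m z t * cnj (sph_harm l m w s)))"

text \<open>The product \<open>(l + k + 1) (l - k)\<close> is the coefficient of the lowering part
  of the ladder operator; this recurrence is what makes the derivative of \<open>sph_kernel\<close>
  telescope.\<close>

lemma fact_ratio_Suc:
  assumes "k < l"
  shows "fact_ratio l (Suc k) * ((real l + real k + 1) * (real l - real k)) = fact_ratio l k"
proof -
  obtain j where l: "l = Suc (k + j)" using assms less_iff_Suc_add by auto
  have "l - k = Suc j" "l - Suc k = j" "l + Suc k = Suc (l + k)" "real l - real k = real (Suc j)"
    "real l + real k + 1 = real (Suc (l + k))" using l by auto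
  then show ?thesis
    unfolding fact_ratio_def by (simp only: fact_Suc) (simp add: divide_simps)
qed

text \<open>Infinitesimal rotation about the first axis acts on the harmonics as a ladder operator.\<close>

lemma sph_harm_has_vector_derivative:
  assumes z: "(z has_vector_derivative - \<i> * of_real (h u)) (at u)"
    and h: "(h has_real_derivative Im (z u)) (at u)"
    and sphere: "(cmod (z u))\<^sup>2 + (h u)\<^sup>2 = 1"
  shows "((\<lambda>u. sph_harm l 0 (z u) (h u)) has_vector_derivative
            of_real (Im (sph_harm l 1 (z u) (h u)))) (at u)"
    and "((\<lambda>u. sph_harm l (Suc k) (z u) (h u)) has_vector_derivative
            - (\<i> / 2) * (sph_harm l (k + 2) (z u) (h u)
              + of_real ((real l + real k + 1) * (real l - real k)) * sph_harm l k (z u) (h u))) (at u)"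
proof -
  have p: "((\<lambda>u. complex_of_real (legendre_deriv l m (h u))) has_vector_derivative
      of_real (legendre_deriv l (Suc m) (h u) * Im (z u))) (at u)" for m
    by (rule has_vector_derivative_of_real)
      (use DERIV_legendre_deriv[OF h] in \<open>simp add: has_real_derivative_iff_has_vector_derivative\<close>)
  show "((\<lambda>u. sph_harm l 0 (z u) (h u)) has_vector_derivative
            of_real (Im (sph_harm l 1 (z u) (h u)))) (at u)"
    using p[of 0] by (simp add: sph_harm_def mult.commute)
  have "((\<lambda>u. z u ^ Suc k) has_vector_derivative
      (of_nat (Suc k) * z u ^ k) * (- \<i> * of_real (h u))) (at u)"
  proof -
    have "((\<lambda>w. w ^ Suc k) has_field_derivative (of_nat (Suc k) * z u ^ k)) (at (z u))"
      by (rule derivative_eq_intros | simp)+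
    from field_vector_diff_chain_at[OF z this] show ?thesis by (simp add: o_def mult.commute)
  qed
  from has_vector_derivative_mult[OF this p[of "Suc k"]]
  have D: "((\<lambda>u. sph_harm l (Suc k) (z u) (h u)) has_vector_derivative
      z u ^ Suc k * of_real (legendre_deriv l (k + 2) (h u) * Im (z u))
      + (of_nat (Suc k) * z u ^ k) * (- \<i> * of_real (h u)) * of_real (legendre_deriv l (k + 1) (h u))) (at u)"
    by (simp add: sph_harm_def)
  have norm: "z u * cnj (z u) = of_real (1 - (h u)\<^sup>2)"
    using sphere by (simp add: complex_norm_square[symmetric] del: of_real_power) (smt (verit) of_real_1 of_real_diff of_real_power)
  have im: "complex_of_real (Im (z u)) = - (\<i> / 2) * (z u - cnj (z u))"
    by (simp add: complex_eq_iff)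
  have ode: "complex_of_real (1 - (h u)\<^sup>2) * of_real (legendre_deriv l (k + 2) (h u))
     = 2 * (of_nat k + 1) * of_real (h u) * of_real (legendre_deriv l (k + 1) (h u))
       - of_real ((real l + real k + 1) * (real l - real k)) * of_real (legendre_deriv l k (h u))"
    using arg_cong[OF legendre_deriv_ode[of "h u" l k], of complex_of_real]
    by (simp only: of_real_mult of_real_diff of_real_add of_real_of_nat_eq of_real_1 of_real_numeral)
  \<comment> \<open>With \<open>Im z\<close> written through \<open>z - cz\<close>, the part with
    \<open>z\<close> raises the order. In the other part \<open>z * cz\<close> equals
    \<open>1 - h^2\<close>, so the differential equation cancels the term with \<open>p1\<close> and
    leaves the order \<open>k\<close>.\<close>
  have alg: "z ^ Suc k * (p2 * (- (\<i> / 2) * (z - cz))) + (of_nat (Suc k) * z ^ k) * (- \<i> * h) * p1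
      = - (\<i> / 2) * (z ^ (k + 2) * p2 + lam * (z ^ k * p0))"
    if "z * cz = q" "q * p2 = 2 * (of_nat k + 1) * h * p1 - lam * p0" for z cz h p0 p1 p2 q lam :: complex
  proof -
    have "z ^ Suc k * (p2 * (- (\<i> / 2) * (z - cz))) + (of_nat (Suc k) * z ^ k) * (- \<i> * h) * p1
       = - (\<i> / 2) * (z ^ (k + 2) * p2 + z ^ k * (2 * (of_nat k + 1) * h * p1 - (z * cz) * p2))"
      by (simp add: field_simps)
    also have "\<dots> = - (\<i> / 2) * (z ^ (k + 2) * p2 + lam * (z ^ k * p0))"
      by (simp only: that) (simp add: mult.left_commute)
    finally show ?thesis .
  qed
  show "((\<lambda>u. sph_harm l (Suc k) (z u) (h u)) has_vector_derivative
            - (\<i> / 2) * (sph_harm l (k + 2) (z u) (h u)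
              + of_real ((real l + real k + 1) * (real l - real k)) * sph_harm l k (z u) (h u))) (at u)"
    using D alg[OF norm ode] unfolding sph_harm_def of_real_mult[of "legendre_deriv l (k + 2) (h u)"] im
    by simp
qed

text \<open>The ladder relations couple an order only to its neighbours, so the derivative of the
  sum telescopes to the boundary term \<open>fact_ratio l l * E l\<close>. This vanishes because the
  derivative of order \<open>l + 1\<close> of a polynomial of degree \<open>l\<close> is
  zero.\<close>

lemma sph_kernel_rotation_derivative:
  assumes z: "(z has_vector_derivative - \<i> * of_real (h u)) (at u)"
    and h: "(h has_real_derivative Im (z u)) (at u)"
    and zh: "(cmod (z u))\<^sup>2 + (h u)\<^sup>2 = 1"
    and w: "(w has_vector_derivative - \<i> * of_real (g u)) (at u)"
    and g: "(g has_real_derivative Im (w u)) (at u)"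
    and wg: "(cmod (w u))\<^sup>2 + (g u)\<^sup>2 = 1"
  shows "((\<lambda>u. sph_kernel l (z u) (h u) (w u) (g u)) has_real_derivative 0) (at u)"
proof -
  define f where "f m = sph_harm l m (z u) (h u)" for m
  define e where "e m = sph_harm l m (w u) (g u)" for m
  define df where "df m = (case m of 0 \<Rightarrow> of_real (Im (f 1)) | Suc k \<Rightarrow>
     - (\<i> / 2) * (f (k + 2) + of_real ((real l + real k + 1) * (real l - real k)) * f k))" for m
  define de where "de m = (case m of 0 \<Rightarrow> of_real (Im (e 1)) | Suc k \<Rightarrow>
     - (\<i> / 2) * (e (k + 2) + of_real ((real l + real k + 1) * (real l - real k)) * e k))" for m
  have df: "((\<lambda>u. sph_harm l m (z u) (h u)) has_vector_derivative df m) (at u)" for m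
    using sph_harm_has_vector_derivative[OF z h zh] by (cases m) (auto simp: df_def f_def)
  have de: "((\<lambda>u. sph_harm l m (w u) (g u)) has_vector_derivative de m) (at u)" for m
    using sph_harm_has_vector_derivative[OF w g wg] by (cases m) (auto simp: de_def e_def)
  have "((\<lambda>u. Re (sph_harm l m (z u) (h u) * cnj (sph_harm l m (w u) (g u)))) has_real_derivative
      Re (f m * cnj (de m) + df m * cnj (e m))) (at u)" for m
    unfolding has_real_derivative_iff_has_vector_derivative
    using bounded_linear.has_vector_derivative[OF bounded_linear_Re
        has_vector_derivative_mult[OF df bounded_linear.has_vector_derivative[OF bounded_linear_cnj de]]]
    by (simp add: f_def e_def)
  then have D: "((\<lambda>u. sph_kernel l (z u) (h u) (w u) (g u)) has_real_derivative
      (\<Sum>m\<le>l. sph_weight l m * Re (f m * cnj (de m) + df m * cnj (e m)))) (at u)"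
    unfolding sph_kernel_def by (auto intro!: DERIV_sum DERIV_cmult)
  define E where "E m = Im (f (Suc m) * cnj (e m)) - Im (f m * cnj (e (Suc m)))" for m
  have tele: "n \<le> l \<Longrightarrow>
    (\<Sum>m\<le>n. sph_weight l m * Re (f m * cnj (de m) + df m * cnj (e m))) = fact_ratio l n * E n" for n
  proof (induction n)
    case 0
    \<comment> \<open>Order 0 has no lower neighbour. Its harmonics are real, so that
      \<open>E 0\<close> is exactly the derivative of the first summand.\<close>
    have "Im (f 0) = 0" "Im (e 0) = 0" by (simp_all add: f_def e_def sph_harm_def)
    then show ?case by (simp add: df_def de_def E_def sph_weight_def fact_ratio_def algebra_simps)
  next
    case (Suc k)
    have *: "Re (f (Suc k) * cnj (de (Suc k)) + df (Suc k) * cnj (e (Suc k)))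
        = (E (Suc k) - (real l + real k + 1) * (real l - real k) * E k) / 2"
      by (simp add: df_def de_def E_def field_simps)
    have "(\<Sum>m\<le>Suc k. sph_weight l m * Re (f m * cnj (de m) + df m * cnj (e m)))
        = fact_ratio l k * E k + sph_weight l (Suc k) * ((E (Suc k) - (real l + real k + 1) * (real l - real k) * E k) / 2)"
      using Suc by (simp only: sum.atMost_Suc *)
    also have "\<dots> = fact_ratio l k * E k + fact_ratio l (Suc k) * E (Suc k)
         - (fact_ratio l (Suc k) * ((real l + real k + 1) * (real l - real k))) * E k"
      by (simp add: sph_weight_def field_simps)
    also have "\<dots> = fact_ratio l (Suc k) * E (Suc k)"
      using Suc.prems by (simp add: fact_ratio_Suc)
    finally show ?case .
  qed
  have "f (Suc l) = 0" "e (Suc l) = 0"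
    by (simp_all add: f_def e_def sph_harm_def legendre_deriv_eq_0)
  then have "E l = 0" by (simp add: E_def)
  with tele[of l] D show ?thesis by simp
qed

theorem legendre_addition:
  assumes zt: "(cmod z)\<^sup>2 + t\<^sup>2 = 1" and ws: "(cmod w)\<^sup>2 + s\<^sup>2 = 1"
  shows "sph_kernel l z t w s = poly (legendre l) (Re (z * cnj w) + t * s)"
proof -
  \<comment> \<open>A rotation about the vertical axis that puts \<open>w * c\<close> on the
    nonnegative imaginary axis, into the plane in which the rotation about the first axis acts. The
    value 1 for \<open>w = 0\<close> keeps the modulus 1.\<close>
  define c where "c = (if w = 0 then 1 else \<i> * cnj w / of_real (cmod w))"
  have c1: "cmod c = 1" by (simp add: c_def norm_mult norm_divide)
  have wc: "w * c = \<i> * of_real (cmod w)"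
    using complex_norm_square[of w]
    by (auto simp: c_def power2_eq_square field_simps)
  have ccnj: "c * cnj c = 1" using c1 by (simp add: complex_norm_square[symmetric])
  have rot3: "sph_kernel l (z * c) t (w * c) s = sph_kernel l z t w s"
  proof -
    have "sph_harm l m (z * c) t * cnj (sph_harm l m (w * c) s) = sph_harm l m z t * cnj (sph_harm l m w s)" for m
    proof -
      have "sph_harm l m (z * c) t * cnj (sph_harm l m (w * c) s)
        = (c * cnj c) ^ m * (sph_harm l m z t * cnj (sph_harm l m w s))"
        by (simp add: sph_harm_def power_mult_distrib)
      then show ?thesis by (simp add: ccnj)
    qed
    then show ?thesis by (simp add: sph_kernel_def)
  qed
  define a b where "a = Re (z * c)" and "b = Im (z * c)"
  define r where "r = cmod w"
  have ab: "a\<^sup>2 + b\<^sup>2 + t\<^sup>2 = 1"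
    using zt c1 by (metis a_def b_def cmod_power2 norm_mult mult.right_neutral)
  have rs: "r\<^sup>2 + s\<^sup>2 = 1" using ws by (simp add: r_def)
  \<comment> \<open>Both points are turned by the angle \<open>u\<close> about the first axis;
    \<open>u = 0\<close> gives the points \<open>z * c\<close>, \<open>t\<close> and
    \<open>w * c\<close>, \<open>s\<close>.\<close>
  define zz where "zz u = Complex a (b * cos u - t * sin u)" for u
  define hh where "hh u = b * sin u + t * cos u" for u
  define ww where "ww u = Complex 0 (r * cos u - s * sin u)" for u
  define gg where "gg u = r * sin u + s * cos u" for u
  have pyth: "(x * cos u - y * sin u)\<^sup>2 + (x * sin u + y * cos u)\<^sup>2 = x\<^sup>2 + y\<^sup>2" for x y u :: real
  proof -
    have "(x * cos u - y * sin u)\<^sup>2 + (x * sin u + y * cos u)\<^sup>2 = (x\<^sup>2 + y\<^sup>2) * ((sin u)\<^sup>2 + (cos u)\<^sup>2)"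
    proof -
      have "(x * c - y * d)\<^sup>2 + (x * d + y * c)\<^sup>2 = (x\<^sup>2 + y\<^sup>2) * (d\<^sup>2 + c\<^sup>2)" for c d :: real
        by (simp add: power2_eq_square algebra_simps)
      then show ?thesis by blast
    qed
    then show ?thesis by (simp only: sin_cos_squared_add mult_1_right)
  qed
  have vd: "((\<lambda>u. Complex x (y * cos u - v * sin u)) has_vector_derivative
      - \<i> * of_real (y * sin u + v * cos u)) (at u)" for x y v u
  proof -
    have "((\<lambda>u. of_real x + \<i> * of_real (y * cos u - v * sin u)) has_vector_derivative
        0 + \<i> * of_real (y * (- sin u) - v * cos u)) (at u)"
      by (intro has_vector_derivative_add has_vector_derivative_const has_vector_derivative_mult_right
          has_vector_derivative_of_real)
        (auto intro!: derivative_eq_intros simp flip: has_real_derivative_iff_has_vector_derivative)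
    moreover have "0 + \<i> * of_real (y * (- sin u) - v * cos u) = - \<i> * of_real (y * sin u + v * cos u)"
      by (simp add: algebra_simps)
    moreover have "(\<lambda>u. Complex x (y * cos u - v * sin u)) = (\<lambda>u. of_real x + \<i> * of_real (y * cos u - v * sin u))"
      by (simp add: Complex_eq)
    ultimately show ?thesis by (simp only:)
  qed
  have "((\<lambda>u. sph_kernel l (zz u) (hh u) (ww u) (gg u)) has_real_derivative 0) (at u)" for u
  proof (rule sph_kernel_rotation_derivative)
    show "(zz has_vector_derivative - \<i> * of_real (hh u)) (at u)"
      unfolding zz_def hh_def by (rule vd)
    show "(ww has_vector_derivative - \<i> * of_real (gg u)) (at u)"
      unfolding ww_def gg_def by (rule vd)
    show "(hh has_real_derivative Im (zz u)) (at u)"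
      unfolding zz_def hh_def by (auto intro!: derivative_eq_intros)
    show "(gg has_real_derivative Im (ww u)) (at u)"
      unfolding ww_def gg_def by (auto intro!: derivative_eq_intros)
    show "(cmod (zz u))\<^sup>2 + (hh u)\<^sup>2 = 1"
      using pyth[of b u t] ab by (simp add: zz_def hh_def cmod_power2)
    show "(cmod (ww u))\<^sup>2 + (gg u)\<^sup>2 = 1"
      using pyth[of r u s] rs by (simp add: ww_def gg_def cmod_power2)
  qed
  then have const: "sph_kernel l (zz u) (hh u) (ww u) (gg u) = sph_kernel l (zz 0) (hh 0) (ww 0) (gg 0)" for u
    using DERIV_isconst_all by blast
  \<comment> \<open>At this angle the second point reaches the pole, \<open>ww u = 0\<close> and
    \<open>gg u = 1\<close>, where the power \<open>0 ^ m\<close> kills every order except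
    0.\<close>
  obtain u where u: "s = cos u" "r = sin u"
    using sincos_total_2pi[of s r] rs by (metis add.commute)
  have "ww u = 0" "gg u = 1"
    using rs by (simp_all add: ww_def gg_def u complex_eq_iff power2_eq_square)
  have "sph_kernel l (zz u) (hh u) 0 1 = poly (legendre l) (hh u)"
  proof -
    have "sph_kernel l (zz u) (hh u) 0 1
       = (\<Sum>m\<le>l. if m = 0 then poly (legendre l) (hh u) else 0)"
      unfolding sph_kernel_def
      by (rule sum.cong) (auto simp: sph_weight_def sph_harm_def legendre_deriv_0 legendre_at_1)
    then show ?thesis by simp
  qed
  moreover have "zz 0 = z * c" "hh 0 = t" "ww 0 = w * c" "gg 0 = s"
    by (simp_all add: zz_def hh_def ww_def gg_def a_def b_def wc r_def complex_eq_iff)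
  ultimately have "sph_kernel l z t w s = poly (legendre l) (hh u)"
    using const[of u] rot3 \<open>ww u = 0\<close> \<open>gg u = 1\<close> by simp
  also have "hh u = Re (z * cnj w) + t * s"
  proof -
    have "Re (z * cnj w) = Re ((z * c) * cnj (w * c))"
    proof -
      have "(z * c) * cnj (w * c) = z * cnj w * (c * cnj c)" by (simp add: mult_ac)
      then show ?thesis by (simp only: ccnj mult_1_right)
    qed
    also have "\<dots> = b * r" unfolding wc by (simp add: b_def r_def)
    finally show ?thesis by (simp add: hh_def u)
  qed
  finally show ?thesis .
qed


section \<open>Harmonics of unit vectors and positive semidefiniteness of the Legendre
  kernels\<close>

definition planar :: "real^3 \<Rightarrow> complex" where
  "planar x = Complex (vec_nth x 1) (vec_nth x 2)"

lemma planar_sphere: "norm x = 1 \<Longrightarrow> (cmod (planar x))\<^sup>2 + (vec_nth x 3)\<^sup>2 = 1"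
  by (simp add: planar_def cmod_power2 norm_eq_1 inner_vec_def sum_3 flip: power2_eq_square)

lemma inner_planar: "inner x y = Re (planar x * cnj (planar y)) + vec_nth x 3 * vec_nth y 3"
  by (simp add: planar_def inner_vec_def sum_3)

definition harmonic :: "nat \<Rightarrow> nat \<Rightarrow> real^3 \<Rightarrow> complex" where
  "harmonic l m x = sph_harm l m (planar x) (vec_nth x 3)"

lemma legendre_inner:
  assumes "norm x = 1" "norm y = 1"
  shows "poly (legendre l) (inner x y) = (\<Sum>m\<le>l. sph_weight l m * Re (harmonic l m x * cnj (harmonic l m y)))"
  using legendre_addition[OF planar_sphere[OF assms(1)] planar_sphere[OF assms(2)]]
  by (simp add: inner_planar sph_kernel_def harmonic_def)

lemma sph_weight_nonneg: "sph_weight l m \<ge> 0"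
  by (simp add: sph_weight_def fact_ratio_def)

text \<open>By the addition theorem the double sum over the points factorizes order by order. The
  formula yields positivity and also shows which linear conditions on \<open>v\<close> make the form
  vanish.\<close>

lemma legendre_quadratic_form:
  fixes x :: "'i \<Rightarrow> real^3"
  assumes "\<And>i. i \<in> I \<Longrightarrow> norm (x i) = 1"
  shows "(\<Sum>i\<in>I. \<Sum>j\<in>I. v i * v j * poly (legendre l) (inner (x i) (x j)))
    = (\<Sum>m\<le>l. sph_weight l m * (cmod (\<Sum>i\<in>I. of_real (v i) * harmonic l m (x i)))\<^sup>2)"
proof -
  have "(cmod (\<Sum>i\<in>I. of_real (v i) * harmonic l m (x i)))\<^sup>2
      = (\<Sum>i\<in>I. \<Sum>j\<in>I. v i * v j * Re (harmonic l m (x i) * cnj (harmonic l m (x j))))" for m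
  proof -
    let ?s = "\<Sum>i\<in>I. of_real (v i) * harmonic l m (x i)"
    have "(cmod ?s)\<^sup>2 = Re (?s * cnj ?s)"
      by (metis Re_complex_of_real complex_norm_square)
    also have "?s * cnj ?s = (\<Sum>i\<in>I. \<Sum>j\<in>I. of_real (v i * v j) * (harmonic l m (x i) * cnj (harmonic l m (x j))))"
      by (simp add: sum_product cnj_sum algebra_simps)
    finally show ?thesis by (simp add: algebra_simps)
  qed
  then have "(\<Sum>m\<le>l. sph_weight l m * (cmod (\<Sum>i\<in>I. of_real (v i) * harmonic l m (x i)))\<^sup>2)
    = (\<Sum>m\<le>l. \<Sum>i\<in>I. \<Sum>j\<in>I. v i * v j * (sph_weight l m * Re (harmonic l m (x i) * cnj (harmonic l m (x j)))))"
    by (simp add: sum_distrib_left mult_ac)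
  also have "\<dots> = (\<Sum>i\<in>I. \<Sum>j\<in>I. \<Sum>m\<le>l. v i * v j * (sph_weight l m * Re (harmonic l m (x i) * cnj (harmonic l m (x j)))))"
    by (subst sum.swap, intro sum.cong refl, rule sum.swap)
  also have "\<dots> = (\<Sum>i\<in>I. \<Sum>j\<in>I. v i * v j * poly (legendre l) (inner (x i) (x j)))"
    by (intro sum.cong refl) (simp add: legendre_inner assms sum_distrib_left)
  finally show ?thesis by simp
qed

lemma legendre_positive_definite:
  fixes x :: "'i \<Rightarrow> real^3"
  assumes "\<And>i. i \<in> I \<Longrightarrow> norm (x i) = 1"
  shows "0 \<le> (\<Sum>i\<in>I. \<Sum>j\<in>I. v i * v j * poly (legendre l) (inner (x i) (x j)))"
proof -
  have "0 \<le> (\<Sum>m\<le>l. sph_weight l m * (cmod (\<Sum>i\<in>I. of_real (v i) * harmonic l m (x i)))\<^sup>2)"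
    by (intro sum_nonneg mult_nonneg_nonneg sph_weight_nonneg) auto
  then show ?thesis by (subst legendre_quadratic_form) (auto intro: assms)
qed

text \<open>Positive semidefiniteness for two points with inner product \<open>t\<close>, tested
  with the vectors (1, 1) and (1, -1), gives \<open>2 + 2 P(t) >= 0\<close> and
  \<open>2 - 2 P(t) >= 0\<close>.\<close>

lemma abs_legendre_le_1:
  assumes "\<bar>t\<bar> \<le> 1"
  shows "\<bar>poly (legendre l) t\<bar> \<le> 1"
proof -
  define x :: "nat \<Rightarrow> real^3" where
    "x i = (if i = 0 then vector [0, 0, 1] else vector [sqrt (1 - t\<^sup>2), 0, t])" for i
  have t2: "t\<^sup>2 \<le> 1" using assms by (simp add: abs_square_le_1)
  have n: "norm (x i) = 1" for i
    using t2 by (auto simp: x_def norm_eq_1 inner_vec_def sum_3 power2_eq_square[symmetric])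
  have i: "inner (x 0) (x 1) = t" "inner (x 1) (x 0) = t"
    by (simp_all add: x_def inner_vec_def sum_3)
  have nn: "inner (x i) (x i) = 1" for i using n by (simp add: norm_eq_1)
  have "0 \<le> (\<Sum>i\<in>{0, 1}. \<Sum>j\<in>{0, 1}. v i * v j * poly (legendre l) (inner (x i) (x j)))" for v
    by (rule legendre_positive_definite) (rule n)
  from this[of "\<lambda>i. 1"] this[of "\<lambda>i. if i = 0 then 1 else - 1"] show ?thesis
    by (simp add: i[simplified] nn legendre_at_1)
qed

section \<open>Legendre expansions\<close>

lemma poly_integrable: "(\<lambda>t. poly p t) integrable_on {a..b::real}"
  by (intro integrable_continuous_real continuous_intros)

lemma poly_has_integral_pderiv:
  "((\<lambda>t. poly (pderiv p) t) has_integral (poly p 1 - poly p (-1))) {-1..1::real}"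
  by (rule fundamental_theorem_of_calculus)
    (auto simp: has_real_derivative_iff_has_vector_derivative[symmetric] intro: DERIV_subset[OF poly_DERIV])

lemma legendre_integral_mult_eq_0:
  "degree q < n \<Longrightarrow> integral {-1..1} (\<lambda>t. poly (legendre n) t * poly q t) = 0"
  by (rule integral_unique) (rule legendre_orthogonal)

lemma legendre_at_minus_1_sq: "(poly (legendre n) (- 1))\<^sup>2 = 1"
proof -
  have "[:-1, 0, 1:] ^ n = [:1, 1:] ^ n * ([:-1, 1:] ^ n :: real poly)"
    by (simp add: legendre_base_eq mult.commute)
  then have "poly (legendre n) (- 1) = (- 1) ^ n"
    using poly_pderiv_funpow_at_root[of n "-1" "[:-1, 1:] ^ n"]
    by (simp add: legendre_def) (metis mult_minus1 power_minus power_mult_distrib mult_1_left power_one minus_mult_left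
        numeral_One mult_minus1_right nonzero_mult_div_cancel_left power_not_zero zero_neq_numeral)
  then show ?thesis by (simp flip: power_mult)
qed

text \<open>With \<open>q = t P' - n P\<close>, in which the leading terms cancel,
  \<open>(t P^2)' = (2 n + 1) P^2 + 2 P q\<close>. The left side integrates to 2 by the values at
  the end points, and \<open>P\<close> is orthogonal to \<open>q\<close>.\<close>

lemma legendre_norm: "integral {-1..1} (\<lambda>t. poly (legendre n * legendre n) t) = 2 / (2 * real n + 1)"
proof -
  let ?P = "legendre n"
  let ?I = "\<lambda>p. integral {-1..1} (\<lambda>t. poly p t)"
  define q where "q = [:0, 1:] * pderiv ?P - Polynomial.smult (real n) ?P"
  have "coeff q k = 0" if "k \<ge> n" for k
    using that degree_legendre[of n] coeff_eq_0[of ?P]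
    by (cases k) (auto simp: q_def coeff_pCons coeff_pderiv le_less algebra_simps)
  then have "q = 0 \<or> degree q < n"
    by (metis leI leading_coeff_0_iff)
  then have q: "?I (?P * q) = 0"
    using legendre_integral_mult_eq_0[of q n] by auto
  have "?I (pderiv ([:0, 1:] * (?P * ?P))) = 2"
    using integral_unique[OF poly_has_integral_pderiv[of "[:0, 1:] * (?P * ?P)"]]
      legendre_at_minus_1_sq[of n] by (simp add: legendre_at_1 power2_eq_square)
  moreover have "pderiv ([:0, 1:] * (?P * ?P)) = Polynomial.smult (2 * real n + 1) (?P * ?P) + Polynomial.smult 2 (?P * q)"
    unfolding q_def by (rule poly_eq_poly_eq_iff[THEN iffD1])
      (simp add: pderiv_mult pderiv_pCons fun_eq_iff algebra_simps)
  moreover have "?I (Polynomial.smult a p + Polynomial.smult b r) = a * ?I p + b * ?I r" for a b :: real and p r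
    using integral_add[OF integrable_on_mult_right integrable_on_mult_right, of "poly p" "{-1..1}" "poly r" a b]
    by (simp add: poly_integrable)
  ultimately have "(2 * real n + 1) * ?I (?P * ?P) + 2 * ?I (?P * q) = 2" by metis
  then have "(2 * real n + 1) * ?I (?P * ?P) = 2" using q by simp
  then show ?thesis by (simp add: field_simps)
qed

text \<open>The factor 1/2 makes these the coefficients with respect to
  \<open>(2 l + 1) P_l\<close>, the normalization that, up to \<open>4 * pi\<close>, also underlies
  \<open>kernel_coeff\<close>.\<close>

definition legendre_coeff :: "real poly \<Rightarrow> nat \<Rightarrow> real" where
  "legendre_coeff p l = integral {-1..1} (\<lambda>t. poly p t * poly (legendre l) t) / 2"

lemma legendre_span:
  assumes "degree p \<le> n"
  shows "\<exists>b. p = (\<Sum>l\<le>n. Polynomial.smult (b l) (legendre l))"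
  using assms
proof (induction n arbitrary: p)
  case 0
  have "legendre 0 = 1" by (simp add: legendre_def)
  moreover obtain a where "p = [:a:]" using 0 degree_eq_zeroE by auto
  ultimately show ?case by auto
next
  case (Suc n)
  let ?P = "legendre (Suc n)"
  have lc: "coeff ?P (Suc n) \<noteq> 0"
    by (metis degree_legendre leading_coeff_0_iff degree_0 nat.distinct(1))
  define a where "a = coeff p (Suc n) / coeff ?P (Suc n)"
  have "coeff (p - Polynomial.smult a ?P) k = 0" if "k > n" for k
    using that Suc.prems lc degree_legendre[of "Suc n"]
    by (cases "k = Suc n") (auto simp: a_def coeff_eq_0)
  then have "degree (p - Polynomial.smult a ?P) \<le> n" by (intro degree_le) auto
  from Suc.IH[OF this] obtain b where b: "p - Polynomial.smult a ?P = (\<Sum>l\<le>n. Polynomial.smult (b l) (legendre l))"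
    by blast
  have "p = (\<Sum>l\<le>Suc n. Polynomial.smult ((b (Suc n := a)) l) (legendre l))"
    using b by (simp add: algebra_simps)
  then show ?case by blast
qed

lemma legendre_orthogonal_distinct:
  "l \<noteq> k \<Longrightarrow> integral {-1..1} (\<lambda>t. poly (legendre l) t * poly (legendre k) t) = 0"
  using legendre_integral_mult_eq_0[of "legendre k" l] legendre_integral_mult_eq_0[of "legendre l" k]
  by (cases "l < k") (auto simp: degree_legendre mult.commute)

lemma legendre_expansion:
  assumes "degree p \<le> n"
  shows "p = (\<Sum>l\<le>n. Polynomial.smult ((2 * real l + 1) * legendre_coeff p l) (legendre l))"
proof -
  obtain b where b: "p = (\<Sum>l\<le>n. Polynomial.smult (b l) (legendre l))"
    using legendre_span[OF assms] by blast
  have "b k = (2 * real k + 1) * legendre_coeff p k" if "k \<le> n" for k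
  proof -
    have "integral {-1..1} (\<lambda>t. poly p t * poly (legendre k) t)
        = integral {-1..1} (\<lambda>t. \<Sum>l\<le>n. b l * (poly (legendre l) t * poly (legendre k) t))"
      by (subst b) (simp add: poly_sum sum_distrib_left mult_ac)
    also have "\<dots> = (\<Sum>l\<le>n. b l * integral {-1..1} (\<lambda>t. poly (legendre l) t * poly (legendre k) t))"
      using poly_integrable[of "legendre _ * legendre k"]
      by (subst integral_sum) (auto intro!: integrable_on_mult_right)
    also have "\<dots> = (\<Sum>l\<le>n. if l = k then b k * (2 / (2 * real k + 1)) else 0)"
      using legendre_norm by (intro sum.cong) (auto simp: legendre_orthogonal_distinct)
    finally have I: "integral {-1..1} (\<lambda>t. poly p t * poly (legendre k) t) = b k * (2 / (2 * real k + 1))"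
      using that by simp
    have "2 * real k + 1 \<noteq> 0" using of_nat_0_le_iff[of k, where 'a = real] by linarith
    then show ?thesis unfolding legendre_coeff_def I by (simp add: divide_simps)
  qed
  then show ?thesis by (subst b) (intro sum.cong, auto)
qed

section \<open>Averages of zonal functions\<close>

text \<open>The \<open>M\<close> equally spaced points on the circle of latitude at height
  \<open>t\<close>. The average over them is exact for harmonics of order below \<open>M\<close> and
  replaces the integral over the circle.\<close>

definition ring_point :: "nat \<Rightarrow> nat \<Rightarrow> real \<Rightarrow> real^3" where
  "ring_point M k t = (let z = of_real (sqrt (1 - t\<^sup>2)) * exp (2 * of_real pi * \<i> * of_nat k / of_nat M)
     in vector [Re z, Im z, t])"

lemma planar_ring_point:
  "planar (ring_point M k t) = of_real (sqrt (1 - t\<^sup>2)) * exp (2 * of_real pi * \<i> * of_nat k / of_nat M)"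
  by (simp add: planar_def ring_point_def Let_def complex_eq_iff)

lemma ring_point_3: "vec_nth (ring_point M k t) 3 = t"
  by (simp add: ring_point_def Let_def)

lemma norm_ring_point:
  assumes "\<bar>t\<bar> \<le> 1"
  shows "norm (ring_point M k t) = 1"
proof -
  have "t\<^sup>2 \<le> 1" using assms by (simp add: abs_square_le_1)
  have "inner (ring_point M k t) (ring_point M k t)
      = (cmod (planar (ring_point M k t)))\<^sup>2 + (vec_nth (ring_point M k t) 3)\<^sup>2"
    by (simp add: planar_def cmod_power2 inner_vec_def sum_3 flip: power2_eq_square)
  also have "cmod (planar (ring_point M k t)) = sqrt (1 - t\<^sup>2)"
    using \<open>t\<^sup>2 \<le> 1\<close> by (simp add: planar_ring_point norm_mult norm_exp_eq_Re)
  finally show ?thesis using \<open>t\<^sup>2 \<le> 1\<close> by (simp add: norm_eq_1 ring_point_3)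
qed

lemma sum_unity_powers:
  assumes "0 < m" "m < M"
  shows "(\<Sum>k<M. exp (2 * of_real pi * \<i> * of_nat k / of_nat M) ^ m) = (0 :: complex)"
proof -
  define w :: complex where "w = exp (2 * of_real pi * \<i> * of_nat m / of_nat M)"
  have "w \<noteq> 1"
    using assms complex_root_unity_eq_1[of M m] by (auto simp: w_def dest: dvd_imp_le)
  moreover have "w ^ M = 1"
    using assms complex_root_unity[of M m] by (simp add: w_def)
  moreover have "exp (2 * of_real pi * \<i> * of_nat k / of_nat M) ^ m = w ^ k" for k
    unfolding w_def exp_of_nat_mult[symmetric] by (simp add: algebra_simps)
  ultimately show ?thesis by (simp add: geometric_sum)
qed

text \<open>The powers of the roots of unity cancel in every order \<open>m\<close> with
  \<open>0 < m < M\<close>, so only the product of the harmonics of order 0 survives.\<close>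

lemma legendre_ring_average:
  assumes l: "l < M" and t: "\<bar>t\<bar> \<le> 1" and y: "norm y = 1"
  shows "(\<Sum>k<M. poly (legendre l) (inner (ring_point M k t) y))
    = real M * poly (legendre l) t * poly (legendre l) (vec_nth y 3)"
proof -
  have "(\<Sum>k<M. poly (legendre l) (inner (ring_point M k t) y))
    = (\<Sum>k<M. \<Sum>m\<le>l. sph_weight l m * Re (harmonic l m (ring_point M k t) * cnj (harmonic l m y)))"
    using norm_ring_point[OF t] y by (simp add: legendre_inner)
  also have "\<dots> = (\<Sum>m\<le>l. sph_weight l m * Re ((\<Sum>k<M. harmonic l m (ring_point M k t)) * cnj (harmonic l m y)))"
    by (subst sum.swap) (simp only: sum_distrib_right Re_sum sum_distrib_left)
  also have "\<dots> = (\<Sum>m\<le>l. if m = 0 then real M * poly (legendre l) t * poly (legendre l) (vec_nth y 3) else 0)"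
  proof (intro sum.cong refl)
    fix m assume "m \<in> {..l}"
    show "sph_weight l m * Re ((\<Sum>k<M. harmonic l m (ring_point M k t)) * cnj (harmonic l m y))
       = (if m = 0 then real M * poly (legendre l) t * poly (legendre l) (vec_nth y 3) else 0)"
    proof (cases "m = 0")
      case True
      then show ?thesis
        by (simp add: harmonic_def sph_harm_def sph_weight_def legendre_deriv_0 ring_point_3)
    next
      case False
      have "(\<Sum>k<M. harmonic l m (ring_point M k t))
        = of_real (sqrt (1 - t\<^sup>2)) ^ m * of_real (legendre_deriv l m t)
          * (\<Sum>k<M. exp (2 * of_real pi * \<i> * of_nat k / of_nat M) ^ m)"
        by (simp add: harmonic_def sph_harm_def planar_ring_point ring_point_3 power_mult_distrib
            sum_distrib_left mult_ac)
      also have "\<dots> = 0"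
        using False \<open>m \<in> {..l}\<close> l by (subst sum_unity_powers) auto
      finally show ?thesis using False by simp
    qed
  qed
  also have "\<dots> = real M * poly (legendre l) t * poly (legendre l) (vec_nth y 3)" by simp
  finally show ?thesis .
qed

text \<open>In the Legendre expansion of \<open>p\<close> the circles turn degree \<open>l\<close>
  into \<open>P_l(t)\<close> times \<open>P_l\<close> at the height of \<open>y\<close>; integration
  over \<open>t\<close> then removes all degrees except 0. What matters is that the result is
  independent of \<open>y\<close>.\<close>

lemma zonal_ring_average:
  assumes p: "degree p < M" and y: "norm y = 1"
  shows "((\<lambda>t. \<Sum>k<M. poly p (inner (ring_point M k t) y)) has_integral
            real M * integral {-1..1} (poly p)) {-1..1}"
proof -
  define n where "n = M - 1"
  have n: "degree p \<le> n" "n < M" using p by (auto simp: n_def)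
  define c where "c l = (2 * real l + 1) * legendre_coeff p l" for l
  have P0: "legendre 0 = 1" by (simp add: legendre_def)
  have p_eq: "poly p u = (\<Sum>l\<le>n. c l * poly (legendre l) u)" for u
    using legendre_expansion[OF n(1)] unfolding c_def
    by (metis (no_types, lifting) poly_smult poly_sum sum.cong)
  have eq: "(\<Sum>k<M. poly p (inner (ring_point M k t) y))
      = (\<Sum>l\<le>n. c l * poly (legendre l) (vec_nth y 3) * real M * poly (legendre l) t)" if "t \<in> {-1..1}" for t
  proof -
    have "(\<Sum>k<M. poly p (inner (ring_point M k t) y))
       = (\<Sum>l\<le>n. c l * (\<Sum>k<M. poly (legendre l) (inner (ring_point M k t) y)))"
      unfolding p_eq by (subst sum.swap) (simp add: sum_distrib_left)
    also have "\<dots> = (\<Sum>l\<le>n. c l * poly (legendre l) (vec_nth y 3) * real M * poly (legendre l) t)"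
      using that n y by (intro sum.cong refl) (subst legendre_ring_average, auto)
    finally show ?thesis .
  qed
  have int: "(poly (legendre l) has_integral (if l = 0 then 2 else 0)) {-1..1}" for l
  proof (cases "l = 0")
    case True
    have "poly (1 :: real poly) = (\<lambda>_. 1)" by (rule ext) simp
    then show ?thesis using True has_integral_const_real[of "1::real" "-1" 1] by (simp add: P0)
  next
    case False
    then show ?thesis using legendre_orthogonal[of 1 l] by simp
  qed
  have "((\<lambda>t. \<Sum>l\<le>n. c l * poly (legendre l) (vec_nth y 3) * real M * poly (legendre l) t) has_integral
     (\<Sum>l\<le>n. c l * poly (legendre l) (vec_nth y 3) * real M * (if l = 0 then 2 else 0))) {-1..1}"
    by (rule has_integral_sum, simp, rule has_integral_mult_right, rule int)
  moreover have "(\<Sum>l\<le>n. c l * poly (legendre l) (vec_nth y 3) * real M * (if l = 0 then 2 else 0))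
     = (\<Sum>l\<le>n. if l = 0 then c 0 * real M * 2 else 0)"
    by (intro sum.cong) (auto simp: P0)
  then have "(\<Sum>l\<le>n. c l * poly (legendre l) (vec_nth y 3) * real M * (if l = 0 then 2 else 0))
     = real M * integral {-1..1} (poly p)"
    by (simp add: c_def legendre_coeff_def P0)
  ultimately show ?thesis by (simp only: has_integral_cong[OF eq])
qed

lemma zonal_integral_nonneg_poly:
  fixes y :: "'j \<Rightarrow> real^3"
  assumes fin: "finite J" and y: "\<And>j. j \<in> J \<Longrightarrow> norm (y j) = 1"
    and nonneg: "\<And>x. norm x = 1 \<Longrightarrow> 0 \<le> (\<Sum>j\<in>J. poly (p j) (inner x (y j)))"
  shows "0 \<le> (\<Sum>j\<in>J. integral {-1..1} (poly (p j)))"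
proof -
  \<comment> \<open>A single \<open>M\<close> above all degrees lets the same ring points serve
    every \<open>j\<close>, so that the two sums can be interchanged.\<close>
  define M where "M = Suc (\<Sum>j\<in>J. degree (p j))"
  have deg: "degree (p j) < M" if "j \<in> J" for j
    using member_le_sum[of j J "\<lambda>j. degree (p j)"] that fin by (simp add: M_def)
  have "((\<lambda>t. \<Sum>j\<in>J. \<Sum>k<M. poly (p j) (inner (ring_point M k t) (y j))) has_integral
     (\<Sum>j\<in>J. real M * integral {-1..1} (poly (p j)))) {-1..1}"
    by (intro has_integral_sum fin zonal_ring_average deg y)
  then have "0 \<le> (\<Sum>j\<in>J. real M * integral {-1..1} (poly (p j)))"
  proof (rule has_integral_nonneg)
    fix t :: real assume "t \<in> {-1..1}"
    then have "norm (ring_point M k t) = 1" for k by (intro norm_ring_point) auto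
    then have "0 \<le> (\<Sum>k<M. \<Sum>j\<in>J. poly (p j) (inner (ring_point M k t) (y j)))"
      by (intro sum_nonneg nonneg)
    then show "0 \<le> (\<Sum>j\<in>J. \<Sum>k<M. poly (p j) (inner (ring_point M k t) (y j)))"
      by (subst sum.swap)
  qed
  moreover have "0 < real M" unfolding M_def of_nat_0_less_iff by simp
  ultimately show ?thesis by (simp add: sum_distrib_left[symmetric] zero_le_mult_iff)
qed

section \<open>Extension from polynomials to continuous zonal functions\<close>

lemma real_poly_approx:
  fixes f :: "real \<Rightarrow> real"
  assumes "continuous_on {a..b} f" "0 < e"
  obtains p where "\<And>t. t \<in> {a..b} \<Longrightarrow> \<bar>f t - poly p t\<bar> < e"
proof -
  have "\<exists>g. real_polynomial_function g \<and> (\<forall>t\<in>{a..b}. \<bar>f t - g t\<bar> < e)"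
    by (rule Stone_Weierstrass_real_polynomial_function) (use assms in auto)
  then obtain g where g: "real_polynomial_function g" "\<forall>t\<in>{a..b}. \<bar>f t - g t\<bar> < e"
    by (elim exE conjE)
  obtain c n where c: "g = (\<lambda>x. \<Sum>i\<le>n. c i * x ^ i)"
    using g(1) unfolding real_polynomial_function_iff_sum by (elim exE)
  show ?thesis
  proof (rule that)
    fix t assume "t \<in> {a..b}"
    then show "\<bar>f t - poly (\<Sum>i\<le>n. Polynomial.monom (c i) i) t\<bar> < e"
      using g(2) by (simp add: poly_sum poly_monom c)
  qed
qed

lemma abs_inner_unit: "norm x = 1 \<Longrightarrow> norm y = 1 \<Longrightarrow> \<bar>inner x y\<bar> \<le> 1"
  using Cauchy_Schwarz_ineq2[of x y] by simp

lemma zonal_integral_nonneg: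
  fixes y :: "'j \<Rightarrow> real^3" and f :: "'j \<Rightarrow> real \<Rightarrow> real"
  assumes fin: "finite J" and y: "\<And>j. j \<in> J \<Longrightarrow> norm (y j) = 1"
    and cont: "\<And>j. j \<in> J \<Longrightarrow> continuous_on {-1..1} (f j)"
    and nonneg: "\<And>x. norm x = 1 \<Longrightarrow> 0 \<le> (\<Sum>j\<in>J. f j (inner x (y j)))"
  shows "0 \<le> (\<Sum>j\<in>J. integral {-1..1} (f j))"
proof (rule field_le_epsilon)
  fix e :: real assume "0 < e"
  \<comment> \<open>Each polynomial raised by \<open>d\<close> lies between \<open>f j\<close> and
    \<open>f j + 2 * d\<close>; over an interval of length 2 this costs \<open>4 * d\<close> per
    index.\<close>
  define d where "d = e / (4 * (real (card J) + 1))"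
  have "0 < d" using \<open>0 < e\<close> by (simp add: d_def)
  have "\<forall>j\<in>J. \<exists>p. \<forall>t\<in>{-1..1}. \<bar>f j t - poly p t\<bar> < d"
    using real_poly_approx[OF cont \<open>0 < d\<close>] by metis
  then obtain p where p: "\<And>j t. j \<in> J \<Longrightarrow> t \<in> {-1..1} \<Longrightarrow> \<bar>f j t - poly (p j) t\<bar> < d"
    by metis
  have "0 \<le> (\<Sum>j\<in>J. integral {-1..1} (poly (p j + [:d:])))"
  proof (rule zonal_integral_nonneg_poly[OF fin y])
    fix x :: "real^3" assume x: "norm x = 1"
    have "0 \<le> (\<Sum>j\<in>J. f j (inner x (y j)))" by (rule nonneg[OF x])
    also have "\<dots> \<le> (\<Sum>j\<in>J. poly (p j + [:d:]) (inner x (y j)))"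
    proof (rule sum_mono)
      fix j assume "j \<in> J"
      then show "f j (inner x (y j)) \<le> poly (p j + [:d:]) (inner x (y j))"
        using p[of j "inner x (y j)"] abs_inner_unit[OF x y[of j]] by (auto simp: abs_le_iff)
    qed
    finally show "0 \<le> (\<Sum>j\<in>J. poly (p j + [:d:]) (inner x (y j)))" .
  qed
  also have "\<dots> \<le> (\<Sum>j\<in>J. integral {-1..1} (f j) + 4 * d)"
  proof (rule sum_mono)
    fix j assume j: "j \<in> J"
    have "integral {-1..1} (poly (p j + [:d:])) \<le> integral {-1..1} (\<lambda>t. f j t + 2 * d)"
    proof (rule integral_le)
      show "(\<lambda>t. f j t + 2 * d) integrable_on {-1..1}"
        by (intro integrable_continuous_real continuous_intros cont j)
      show "poly (p j + [:d:]) t \<le> f j t + 2 * d" if "t \<in> {-1..1}" for t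
        using p[OF j that] by auto
    qed (rule poly_integrable)
    also have "\<dots> = integral {-1..1} (f j) + 4 * d"
      using integrable_continuous_real[OF cont[OF j]] by (subst Henstock_Kurzweil_Integration.integral_add) auto
    finally show "integral {-1..1} (poly (p j + [:d:])) \<le> integral {-1..1} (f j) + 4 * d" .
  qed
  also have "\<dots> = (\<Sum>j\<in>J. integral {-1..1} (f j)) + real (card J) * (4 * d)"
    by (simp add: sum.distrib)
  also have "real (card J) * (4 * d) \<le> e"
    using \<open>0 < e\<close> by (simp add: d_def field_simps)
  finally show "0 \<le> (\<Sum>j\<in>J. integral {-1..1} (f j)) + e" by simp
qed

text \<open>Nonnegativity of the average is applied to the family of all \<open>- f j\<close>
  enlarged by \<open>g\<close>; the extra index \<open>None\<close> carries \<open>g\<close> with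
  its own centre \<open>z\<close>.\<close>

lemma zonal_integral_mono:
  fixes y :: "'j \<Rightarrow> real^3" and f :: "'j \<Rightarrow> real \<Rightarrow> real"
  assumes fin: "finite J" and y: "\<And>j. j \<in> J \<Longrightarrow> norm (y j) = 1" and z: "norm z = 1"
    and cont: "\<And>j. j \<in> J \<Longrightarrow> continuous_on {-1..1} (f j)" "continuous_on {-1..1} g"
    and le: "\<And>x. norm x = 1 \<Longrightarrow> (\<Sum>j\<in>J. f j (inner x (y j))) \<le> g (inner x z)"
  shows "(\<Sum>j\<in>J. integral {-1..1} (f j)) \<le> integral {-1..1} g"
proof -
  let ?K = "insert None (Some ` J)"
  let ?F = "\<lambda>k. case k of None \<Rightarrow> g | Some j \<Rightarrow> (\<lambda>t. - f j t)"
  let ?Y = "\<lambda>k. case k of None \<Rightarrow> z | Some j \<Rightarrow> y j"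
  have sum: "(\<Sum>k\<in>?K. h k) = h None + (\<Sum>j\<in>J. h (Some j))" for h :: "'j option \<Rightarrow> real"
  proof -
    have "(\<Sum>k\<in>?K. h k) = h None + (\<Sum>k\<in>Some ` J. h k)"
      using fin by (intro sum.insert) auto
    also have "(\<Sum>k\<in>Some ` J. h k) = (\<Sum>j\<in>J. h (Some j))"
      by (subst sum.reindex) (auto simp: o_def)
    finally show ?thesis .
  qed
  have "0 \<le> (\<Sum>k\<in>?K. integral {-1..1} (?F k))"
  proof (rule zonal_integral_nonneg[where y = ?Y])
    show "0 \<le> (\<Sum>k\<in>?K. ?F k (inner x (?Y k)))" if "norm x = 1" for x
      using le[OF that] unfolding sum by (simp add: sum_negf)
    show "norm (?Y k) = 1" if "k \<in> ?K" for k using that y z by auto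
    show "continuous_on {-1..1} (?F k)" if "k \<in> ?K" for k
      using that cont(2) continuous_on_minus[OF cont(1)] by auto
  qed (use fin in simp)
  then have "0 \<le> integral {-1..1} g + (\<Sum>j\<in>J. integral {-1..1} (\<lambda>t. - f j t))"
    unfolding sum by (simp only: option.case)
  then show ?thesis by (simp add: sum_negf)
qed

section \<open>Packing and covering\<close>

lemma ramp_integral:
  assumes "-1 \<le> a" "a \<le> (1::real)"
  shows "((\<lambda>t. max 0 (t - a)) has_integral (1 - a)\<^sup>2 / 2) {-1..1}"
proof -
  have 1: "((\<lambda>t. max 0 (t - a)) has_integral 0) {-1..a}"
    by (rule has_integral_is_0) auto
  have "((\<lambda>t. t - a) has_integral (1 - a)\<^sup>2 / 2 - (a - a)\<^sup>2 / 2) {a..1}"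
    by (rule fundamental_theorem_of_calculus)
      (use assms in \<open>auto intro!: derivative_eq_intros simp: has_real_derivative_iff_has_vector_derivative[symmetric]\<close>)
  then have 2: "((\<lambda>t. max 0 (t - a)) has_integral (1 - a)\<^sup>2 / 2) {a..1}"
    by (subst has_integral_cong[of _ _ "\<lambda>t. t - a"]) auto
  from has_integral_combine[OF assms 1 2] show ?thesis by simp
qed

text \<open>The averaging argument applies to continuous functions, so the indicator of a cap is
  replaced by this linear transition from 0 at \<open>a\<close> to 1 at \<open>b\<close>.\<close>

definition ramp :: "real \<Rightarrow> real \<Rightarrow> real \<Rightarrow> real" where
  "ramp a b t = (max 0 (t - a) - max 0 (t - b)) / (b - a)"

lemma ramp_bounds: "a < b \<Longrightarrow> 0 \<le> ramp a b t" "a < b \<Longrightarrow> ramp a b t \<le> 1"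
  by (auto simp: ramp_def field_simps max_def)

lemma ramp_eq_0: "a < b \<Longrightarrow> t \<le> a \<Longrightarrow> ramp a b t = 0"
  by (auto simp: ramp_def max_def)

lemma ramp_eq_1: "a < b \<Longrightarrow> b \<le> t \<Longrightarrow> ramp a b t = 1"
  by (auto simp: ramp_def max_def field_simps)

lemma continuous_on_ramp: "continuous_on S (ramp a b)"
  unfolding ramp_def by (cases "a = b") (auto intro!: continuous_intros)

lemma integral_ramp:
  assumes "-1 \<le> a" "a < b" "b \<le> 1"
  shows "integral {-1..1} (ramp a b) = 1 - (a + b) / 2"
proof -
  have "(ramp a b has_integral ((1 - a)\<^sup>2 / 2 - (1 - b)\<^sup>2 / 2) / (b - a)) {-1..1}"
    unfolding ramp_def using assms by (intro has_integral_divide has_integral_diff ramp_integral) auto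
  moreover have "((1 - a)\<^sup>2 / 2 - (1 - b)\<^sup>2 / 2) = (b - a) * (1 - (a + b) / 2)"
    by (simp add: field_simps power2_eq_square)
  ultimately show ?thesis using assms by (simp add: integral_unique)
qed

lemma norm_diff_unit:
  fixes x y :: "real^3"
  assumes "norm x = 1" "norm y = 1"
  shows "(norm (x - y))\<^sup>2 = 2 - 2 * inner x y"
  using assms unfolding power2_norm_eq_inner
  by (simp add: norm_eq_1 inner_diff_left inner_diff_right inner_commute)

text \<open>A spherical cap of chordal radius \<open>\<rho> / 2\<close> fills the fraction \<open>\<rho>\<^sup>2 / 16\<close> of the sphere.\<close>

lemma packing_weights:
  fixes y :: "'j \<Rightarrow> real^3"
  assumes fin: "finite J" and y: "\<And>j. j \<in> J \<Longrightarrow> norm (y j) = 1" and p: "norm p = 1"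
    and \<rho>: "0 < \<rho>" "\<rho> \<le> 2"
    and sep: "\<And>i j. i \<in> J \<Longrightarrow> j \<in> J \<Longrightarrow> i \<noteq> j \<Longrightarrow> \<rho> \<le> norm (y i - y j)"
    and cont: "continuous_on {-1..1} g" and g: "\<And>t. t \<in> {-1..1} \<Longrightarrow> 0 \<le> g t"
    and w0: "\<And>j. j \<in> J \<Longrightarrow> 0 \<le> w j"
    and w: "\<And>j x. j \<in> J \<Longrightarrow> norm x = 1 \<Longrightarrow> norm (x - y j) < \<rho> / 2 \<Longrightarrow> w j \<le> g (inner x p)"
  shows "\<rho>\<^sup>2 / 8 * (\<Sum>j\<in>J. w j) \<le> integral {-1..1} g"
proof (rule field_le_epsilon)
  fix e :: real assume "0 < e"
  \<comment> \<open>Since \<open>|x - y|^2 = 2 - 2 t\<close>, the heights above \<open>a\<close>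
    form the cap of chordal radius \<open>\<rho> / 2\<close>. The ramp of width \<open>d\<close>
    rises inside it and loses only \<open>d / 2\<close> of the integral.\<close>
  define a where "a = 1 - \<rho>\<^sup>2 / 8"
  define W where "W = (\<Sum>j\<in>J. w j)"
  have "0 \<le> W" unfolding W_def by (intro sum_nonneg w0)
  define d where "d = min (\<rho>\<^sup>2 / 8) (e / (W + 1))"
  have d: "0 < d" "d \<le> \<rho>\<^sup>2 / 8" "W * (d / 2) \<le> e"
  proof -
    show "0 < d" using \<rho> \<open>0 < e\<close> \<open>0 \<le> W\<close> by (auto simp: d_def)
    show "d \<le> \<rho>\<^sup>2 / 8" unfolding d_def by (rule min.cobounded1)
    have "W * (d / 2) \<le> (W + 1) * d" using \<open>0 \<le> W\<close> \<open>0 < d\<close> by (intro mult_mono) auto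
    also have "\<dots> \<le> (W + 1) * (e / (W + 1))" using \<open>0 \<le> W\<close> by (intro mult_left_mono) (auto simp: d_def)
    also have "\<dots> = e" using \<open>0 \<le> W\<close> by simp
    finally show "W * (d / 2) \<le> e" .
  qed
  have "\<rho>\<^sup>2 \<le> 2\<^sup>2" using \<rho> by (intro power_mono) auto
  then have a: "-1 \<le> a" "a + d \<le> 1" using d by (auto simp: a_def)
  have "(\<Sum>j\<in>J. integral {-1..1} (\<lambda>t. w j * ramp a (a + d) t)) \<le> integral {-1..1} g"
  proof (rule zonal_integral_mono[OF fin y p _ cont])
    show "continuous_on {-1..1} (\<lambda>t. w j * ramp a (a + d) t)" for j
      by (intro continuous_intros continuous_on_ramp)
    fix x :: "real^3" assume x: "norm x = 1"
    have near: "norm (x - y j) < \<rho> / 2" if "j \<in> J" "ramp a (a + d) (inner x (y j)) \<noteq> 0" for j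
    proof -
      have "a < inner x (y j)" using that(2) ramp_eq_0[of a "a + d" "inner x (y j)"] d(1) by linarith
      then have "(norm (x - y j))\<^sup>2 < (\<rho> / 2)\<^sup>2"
        unfolding norm_diff_unit[OF x y[OF that(1)]] by (simp add: a_def power_divide)
      then show ?thesis by (rule power2_less_imp_less) (use \<rho> in simp)
    qed
    have gx: "0 \<le> g (inner x p)"
      using g abs_inner_unit[OF x p] by (auto simp: abs_le_iff)
    show "(\<Sum>j\<in>J. w j * ramp a (a + d) (inner x (y j))) \<le> g (inner x p)"
    proof (cases "\<exists>i\<in>J. ramp a (a + d) (inner x (y i)) \<noteq> 0")
      case False
      then have "(\<Sum>j\<in>J. w j * ramp a (a + d) (inner x (y j))) = 0" by (intro sum.neutral) auto
      then show ?thesis using gx by simp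
    next
      case True
      then obtain i where i: "i \<in> J" "ramp a (a + d) (inner x (y i)) \<noteq> 0" by blast
      \<comment> \<open>Two caps cannot both contain \<open>x\<close>, for their centres would be
        closer than \<open>\<rho>\<close>.\<close>
      have "ramp a (a + d) (inner x (y j)) = 0" if "j \<in> J - {i}" for j
      proof (rule ccontr)
        assume "ramp a (a + d) (inner x (y j)) \<noteq> 0"
        with that near i have "norm (x - y j) < \<rho> / 2" "norm (x - y i) < \<rho> / 2" by auto
        then have "norm (y i - y j) < \<rho>"
          using norm_triangle_ineq4[of "x - y j" "x - y i"] by simp
        with sep[of i j] i that show False by auto
      qed
      then have "(\<Sum>j\<in>J. w j * ramp a (a + d) (inner x (y j))) = w i * ramp a (a + d) (inner x (y i))"
        using fin i by (subst sum.remove[of J i]) auto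
      also have "\<dots> \<le> w i" using w0[OF i(1)] ramp_bounds(2)[of a "a + d"] d
        by (simp add: mult_left_le)
      also have "\<dots> \<le> g (inner x p)" by (rule w[OF i(1) x near[OF i]])
      finally show ?thesis .
    qed
  qed
  moreover have "integral {-1..1} (ramp a (a + d)) = 1 - (a + (a + d)) / 2"
    by (rule integral_ramp) (use a d in auto)
  moreover have "1 - (a + (a + d)) / 2 = \<rho>\<^sup>2 / 8 - d / 2" by (simp add: a_def field_simps)
  ultimately have "W * (\<rho>\<^sup>2 / 8 - d / 2) \<le> integral {-1..1} g"
    by (simp add: W_def sum_distrib_right)
  then show "\<rho>\<^sup>2 / 8 * (\<Sum>j\<in>J. w j) \<le> integral {-1..1} g + e"
    using d(3) unfolding W_def[symmetric] by (simp add: algebra_simps)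
qed

lemma packing_number:
  fixes y :: "'j \<Rightarrow> real^3"
  assumes "finite J" "\<And>j. j \<in> J \<Longrightarrow> norm (y j) = 1" "0 < \<rho>" "\<rho> \<le> 2"
    and "\<And>i j. i \<in> J \<Longrightarrow> j \<in> J \<Longrightarrow> i \<noteq> j \<Longrightarrow> \<rho> \<le> norm (y i - y j)"
  shows "real (card J) * \<rho>\<^sup>2 \<le> 16"
proof -
  \<comment> \<open>A constant \<open>g\<close> is zonal about every unit vector, so that any centre
    will do.\<close>
  have "norm (axis 1 1 :: real^3) = 1" by simp
  from packing_weights[OF assms(1,2) this assms(3-5), where g = "\<lambda>_. 1" and w = "\<lambda>_. 1"]
  have "\<rho>\<^sup>2 / 8 * real (card J) \<le> 2" by simp
  then show ?thesis by (simp add: field_simps)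
qed

lemma covering_number:
  fixes y :: "'j \<Rightarrow> real^3"
  assumes fin: "finite J" and y: "\<And>j. j \<in> J \<Longrightarrow> norm (y j) = 1" and c: "-1 < c" "c \<le> 1"
    and cover: "\<And>x. norm x = 1 \<Longrightarrow> \<exists>j\<in>J. c \<le> inner x (y j)"
  shows "2 \<le> real (card J) * (1 - c)"
proof (rule field_le_epsilon)
  fix e :: real assume "0 < e"
  \<comment> \<open>The bound \<open>1 + c\<close> keeps the start \<open>c - d\<close> of the ramp
    inside [-1, 1]; the other one keeps the error at most \<open>e\<close>.\<close>
  define d where "d = min (1 + c) (e / (real (card J) + 1))"
  have d: "0 < d" "d \<le> 1 + c" "real (card J) * (d / 2) \<le> e"
  proof -
    show "0 < d" "d \<le> 1 + c" using c \<open>0 < e\<close> by (auto simp: d_def)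
    have "real (card J) * (d / 2) \<le> (real (card J) + 1) * d" using \<open>0 < d\<close> by (intro mult_mono) auto
    also have "\<dots> \<le> (real (card J) + 1) * (e / (real (card J) + 1))" by (intro mult_left_mono) (auto simp: d_def)
    also have "\<dots> = e" by simp
    finally show "real (card J) * (d / 2) \<le> e" .
  qed
  have z: "norm (axis 1 1 :: real^3) = 1" by simp
  \<comment> \<open>Both sides are negated because the sum of the ramps is bounded from below,
    namely by 1.\<close>
  have "(\<Sum>j\<in>J. integral {-1..1} (\<lambda>t. - ramp (c - d) c t)) \<le> integral {-1..1} (\<lambda>t::real. - 1::real)"
  proof (rule zonal_integral_mono[OF fin y z])
    show "continuous_on {-1..1} (\<lambda>t. - ramp (c - d) c t)"
      by (intro continuous_intros continuous_on_ramp)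
    fix x :: "real^3" assume "norm x = 1"
    with cover obtain i where i: "i \<in> J" "c \<le> inner x (y i)" by blast
    have "1 = ramp (c - d) c (inner x (y i))" using i d by (simp add: ramp_eq_1)
    also have "\<dots> \<le> (\<Sum>j\<in>J. ramp (c - d) c (inner x (y j)))"
      using fin i d by (intro member_le_sum) (auto intro: ramp_bounds)
    finally show "(\<Sum>j\<in>J. - ramp (c - d) c (inner x (y j))) \<le> - 1"
      by (simp add: sum_negf)
  qed auto
  then show "2 \<le> real (card J) * (1 - c) + e"
    using d c by (simp add: integral_ramp algebra_simps add_divide_distrib diff_divide_distrib)
qed

section \<open>Inverse square sums over separated points\<close>

lemma inverse_square_integral:
  assumes "0 < (d::real)"
  shows "((\<lambda>t. 1 / (d + 1 - t)\<^sup>2) has_integral (1 / d - 1 / (d + 2))) {-1..1}"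
proof -
  have "((\<lambda>t. 1 / (d + 1 - t)\<^sup>2) has_integral (1 / (d + 1 - 1) - 1 / (d + 1 - (-1)))) {-1..1}"
  proof (rule fundamental_theorem_of_calculus)
    fix t :: real assume "t \<in> {-1..1}"
    then have "((\<lambda>t. 1 / (d + 1 - t)) has_real_derivative 1 / (d + 1 - t)\<^sup>2) (at t within {-1..1})"
      using assms by (auto intro!: derivative_eq_intros simp: power2_eq_square)
    then show "((\<lambda>t. 1 / (d + 1 - t)) has_vector_derivative 1 / (d + 1 - t)\<^sup>2) (at t within {-1..1})"
      by (simp add: has_real_derivative_iff_has_vector_derivative)
  qed simp
  then show ?thesis by (simp add: add.commute)
qed

text \<open>On the cap of radius \<open>\<rho> / 2\<close> about \<open>y j\<close> the summand is
  at most the function \<open>25 / (d + 1 - t)^2\<close> centred at \<open>y i\<close>, so the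
  packing argument turns the sum into an integral. The shift \<open>d\<close> moves the singularity
  out of [-1, 1]; the integral is at most \<open>25 / d = 200 / \<rho>^2\<close>, whence
  1600.\<close>

lemma separated_inverse_square_sum:
  fixes y :: "'j \<Rightarrow> real^3"
  assumes fin: "finite J" and y: "\<And>j. j \<in> J \<Longrightarrow> norm (y j) = 1" and \<rho>: "0 < \<rho>" "\<rho> \<le> 2"
    and sep: "\<And>i j. i \<in> J \<Longrightarrow> j \<in> J \<Longrightarrow> i \<noteq> j \<Longrightarrow> \<rho> \<le> norm (y i - y j)"
    and i: "i \<in> J"
  shows "(\<Sum>j\<in>J - {i}. 4 / (1 - inner (y i) (y j))\<^sup>2) \<le> 1600 / \<rho> ^ 4"
proof -
  define d where "d = \<rho>\<^sup>2 / 8"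
  have d: "0 < d" using \<rho> by (simp add: d_def)
  let ?g = "\<lambda>t. 25 * (1 / (d + 1 - t)\<^sup>2)"
  have "\<rho>\<^sup>2 / 8 * (\<Sum>j\<in>J - {i}. 4 / (1 - inner (y i) (y j))\<^sup>2) \<le> integral {-1..1} ?g"
  proof (rule packing_weights[where p = "y i"])
    show "continuous_on {-1..1} ?g"
      using d by (auto intro!: continuous_intros)
    show "4 / (1 - inner (y i) (y j))\<^sup>2 \<le> ?g (inner x (y i))"
      if j: "j \<in> J - {i}" and x: "norm x = 1" "norm (x - y j) < \<rho> / 2" for j x
    proof -
      define u where "u = norm (y i - y j)"
      have u: "\<rho> \<le> u" using sep[of i j] i j by (auto simp: u_def)
      have eq: "1 - inner (y i) (y j) = u\<^sup>2 / 2"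
        using norm_diff_unit[OF y[OF i] y[of j]] j by (simp add: u_def)
      have "norm (x - y i) \<le> 3 / 2 * u"
        using norm_triangle_ineq4[of "x - y j" "y i - y j"] x(2) u by (simp add: u_def)
      then have "(norm (x - y i))\<^sup>2 \<le> (3 / 2 * u)\<^sup>2" by (intro power_mono) auto
      then have le: "1 - inner x (y i) \<le> 9 / 8 * u\<^sup>2"
        unfolding norm_diff_unit[OF x(1) y[OF i]] by (simp add: power_mult_distrib power2_eq_square)
      have "\<rho>\<^sup>2 \<le> u\<^sup>2" using u \<rho> by (intro power_mono) auto
      \<comment> \<open>Here \<open>1 - t\<close> is at most \<open>9/8 u^2\<close> and
        \<open>d\<close> at most \<open>1/8 u^2\<close>. The 25 is chosen to cancel the numerator of
        \<open>(5/4)^2\<close> and to leave \<open>16 / u^4\<close>.\<close>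
      with le have "d + 1 - inner x (y i) \<le> 5 / 4 * u\<^sup>2" by (simp add: d_def)
      moreover have pos: "0 < d + 1 - inner x (y i)"
        using d abs_inner_unit[OF x(1) y[OF i]] by auto
      ultimately have "(d + 1 - inner x (y i))\<^sup>2 \<le> (5 / 4 * u\<^sup>2)\<^sup>2" by (intro power_mono) auto
      then have "25 / (5 / 4 * u\<^sup>2)\<^sup>2 \<le> 25 / (d + 1 - inner x (y i))\<^sup>2"
        using pos u \<rho> by (intro divide_left_mono mult_pos_pos) auto
      moreover have "25 / (5 / 4 * u\<^sup>2)\<^sup>2 = 4 / (1 - inner (y i) (y j))\<^sup>2"
        unfolding eq by (simp add: power_mult_distrib power_divide)
      ultimately show ?thesis by simp
    qed
  qed (use fin y sep i \<rho> in auto)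
  also have "integral {-1..1} ?g = 25 * (1 / d - 1 / (d + 2))"
    by (rule integral_unique) (rule has_integral_mult_right[OF inverse_square_integral[OF d]])
  also have "\<dots> \<le> 25 * (1 / d)" using d by simp
  also have "\<dots> = 200 / \<rho>\<^sup>2" by (simp add: d_def)
  finally have "(\<Sum>j\<in>J - {i}. 4 / (1 - inner (y i) (y j))\<^sup>2) * \<rho>\<^sup>2 * \<rho>\<^sup>2 \<le> 1600"
    using \<rho> by (simp add: field_simps)
  then show ?thesis using \<rho> by (simp add: field_simps power4_eq_xxxx power2_eq_square)
qed

section \<open>Extreme eigenvalues\<close>

lemma quadratic_form_upper_bound:
  fixes A :: "real Matrix.mat"
  assumes A: "A \<in> carrier_mat n n"
  obtains c where "0 < c" "\<And>v. v \<in> carrier_vec n \<Longrightarrow> scalar_prod v (A *\<^sub>v v) \<le> c * scalar_prod v v"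
proof
  define K where "K = (\<Sum>i<n. \<Sum>j<n. \<bar>A $$ (i, j)\<bar>)"
  have K: "\<bar>A $$ (i, j)\<bar> \<le> K" if "i < n" "j < n" for i j
  proof -
    have "\<bar>A $$ (i, j)\<bar> \<le> (\<Sum>j<n. \<bar>A $$ (i, j)\<bar>)"
      using that by (intro member_le_sum) auto
    also have "\<dots> \<le> K" unfolding K_def
      using that by (intro member_le_sum[where f = "\<lambda>i. \<Sum>j<n. \<bar>A $$ (i, j)\<bar>"]) (auto intro: sum_nonneg)
    finally show ?thesis .
  qed
  have "0 \<le> K" unfolding K_def by (intro sum_nonneg) auto
  \<comment> \<open>The summand 1 keeps the constant positive even for the zero matrix, since it is
    divided by later.\<close>
  then show "0 < K * real n + 1" by (intro add_nonneg_pos) auto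
  fix v :: "real Matrix.vec" assume v: "v \<in> carrier_vec n"
  have vv: "scalar_prod v v = (\<Sum>i<n. (vec_index v i)\<^sup>2)"
    using v by (simp add: scalar_prod_def atLeast0LessThan power2_eq_square)
  have "scalar_prod v (A *\<^sub>v v) = (\<Sum>i<n. \<Sum>j<n. vec_index v i * (A $$ (i, j) * vec_index v j))"
    using v A by (simp add: scalar_prod_def atLeast0LessThan sum_distrib_left)
  also have "\<dots> \<le> (\<Sum>i<n. \<Sum>j<n. K * ((vec_index v i)\<^sup>2 + (vec_index v j)\<^sup>2) / 2)"
  proof (intro sum_mono)
    fix i j assume ij: "i \<in> {..<n}" "j \<in> {..<n}"
    have "vec_index v i * (A $$ (i, j) * vec_index v j) \<le> \<bar>A $$ (i, j)\<bar> * \<bar>vec_index v i * vec_index v j\<bar>"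
      by (metis abs_ge_self abs_mult mult.left_commute)
    also have "\<dots> \<le> K * (((vec_index v i)\<^sup>2 + (vec_index v j)\<^sup>2) / 2)"
    proof (rule mult_mono)
      have "2 * \<bar>vec_index v i * vec_index v j\<bar> \<le> (vec_index v i)\<^sup>2 + (vec_index v j)\<^sup>2"
        using sum_squares_bound[of "\<bar>vec_index v i\<bar>" "\<bar>vec_index v j\<bar>"] by (simp add: abs_mult)
      then show "\<bar>vec_index v i * vec_index v j\<bar> \<le> ((vec_index v i)\<^sup>2 + (vec_index v j)\<^sup>2) / 2" by simp
    qed (use K ij \<open>0 \<le> K\<close> in auto)
    finally show "vec_index v i * (A $$ (i, j) * vec_index v j) \<le> K * ((vec_index v i)\<^sup>2 + (vec_index v j)\<^sup>2) / 2"
      by simp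
  qed
  also have "\<dots> = K * real n * scalar_prod v v"
    by (simp add: vv sum.distrib sum_distrib_left sum_divide_distrib[symmetric] sum_distrib_right
        algebra_simps add_divide_distrib flip: sum_distrib_left)
  also have "\<dots> \<le> (K * real n + 1) * scalar_prod v v"
    by (intro mult_right_mono) (auto simp: vv intro: sum_nonneg)
  finally show "scalar_prod v (A *\<^sub>v v) \<le> (K * real n + 1) * scalar_prod v v" .
qed

lemma scalar_prod_self_pos:
  fixes v :: "real Matrix.vec"
  assumes "v \<in> carrier_vec n" "v \<noteq> 0\<^sub>v n"
  shows "0 < scalar_prod v v"
proof -
  obtain i where "i < n" "vec_index v i \<noteq> 0"
    using assms by (metis carrier_vecD eq_vecI index_zero_vec)
  then have "0 < (\<Sum>i = 0..<n. vec_index v i * vec_index v i)"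
    by (intro sum_pos2[of _ i]) (auto simp: zero_less_mult_iff neq_iff)
  then show ?thesis using assms by (simp add: scalar_prod_def)
qed

text \<open>
  The infimum of the Rayleigh quotient is an eigenvalue: otherwise \<open>A - \<mu>\<close> would be invertible and
  positive semidefinite, hence bounded below by a positive multiple of the identity.
\<close>

lemma minimal_eigenvalue:
  fixes A :: "real Matrix.mat"
  assumes A: "A \<in> carrier_mat n n" and sym: "transpose_mat A = A" and n: "0 < n"
  shows "\<exists>\<mu>\<in>spectrum A. \<forall>v\<in>carrier_vec n. \<mu> * scalar_prod v v \<le> scalar_prod v (A *\<^sub>v v)"
proof -
  define R where "R = {scalar_prod v (A *\<^sub>v v) | v. v \<in> carrier_vec n \<and> scalar_prod v v = 1}"
  define \<mu> where "\<mu> = Inf R"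
  have u: "unit_vec n 0 \<in> carrier_vec n" "scalar_prod (unit_vec n 0) (unit_vec n 0) = (1::real)"
    using n by auto
  then have "R \<noteq> {}" unfolding R_def by blast
  obtain b where b: "0 < b" "\<And>v. v \<in> carrier_vec n \<Longrightarrow> scalar_prod v ((- A) *\<^sub>v v) \<le> b * scalar_prod v v"
    using quadratic_form_upper_bound[of "- A" n] A by auto
  have "bdd_below R"
  proof (rule bdd_belowI)
    fix r assume "r \<in> R"
    then obtain v where v: "v \<in> carrier_vec n" "scalar_prod v v = 1" "r = scalar_prod v (A *\<^sub>v v)"
      unfolding R_def by blast
    then show "- b \<le> r" using b(2)[OF v(1)] A by simp
  qed
  have low: "\<mu> * scalar_prod v v \<le> scalar_prod v (A *\<^sub>v v)" if v: "v \<in> carrier_vec n" for v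
  proof (cases "v = 0\<^sub>v n")
    case True
    then show ?thesis using A by simp
  next
    case False
    then have pos: "0 < scalar_prod v v" using v scalar_prod_self_pos by blast
    define s where "s = 1 / sqrt (scalar_prod v v)"
    have s2: "s * s * scalar_prod v v = 1" using pos by (simp add: s_def)
    define w where "w = s \<cdot>\<^sub>v v"
    have w: "w \<in> carrier_vec n" using v by (simp add: w_def)
    have "scalar_prod w w = 1" using v s2 by (simp add: w_def)
    then have "scalar_prod w (A *\<^sub>v w) \<in> R" using w unfolding R_def by blast
    then have "\<mu> \<le> scalar_prod w (A *\<^sub>v w)"
      unfolding \<mu>_def using \<open>bdd_below R\<close> by (intro cInf_lower)
    also have "\<dots> = s * s * scalar_prod v (A *\<^sub>v v)"
      using v A by (simp add: w_def mult_mat_vec[OF A v] scalar_prod_smult_distrib[of v n])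
    finally have "\<mu> * scalar_prod v v \<le> s * s * scalar_prod v (A *\<^sub>v v) * scalar_prod v v"
      using pos by simp
    also have "\<dots> = scalar_prod v (A *\<^sub>v v)" using s2 by (simp add: algebra_simps)
    finally show ?thesis .
  qed
  have "\<mu> \<in> spectrum A"
  proof (rule ccontr)
    assume "\<mu> \<notin> spectrum A"
    define C where "C = char_matrix A \<mu>"
    have C: "C \<in> carrier_mat n n" using A by (simp add: C_def)
    have "Determinant.det C \<noteq> 0"
      using \<open>\<mu> \<notin> spectrum A\<close> eigenvalue_det[OF A] by (simp add: spectrum_def C_def)
    from det_non_zero_imp_unit[OF C this, of "()"]
    obtain D where D: "D \<in> carrier_mat n n" "D * C = 1\<^sub>m n"
      by (auto simp: Units_def ring_mat_simps)
    have Cv: "C *\<^sub>v v = A *\<^sub>v v - \<mu> \<cdot>\<^sub>v v" if v: "v \<in> carrier_vec n" for v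
    proof -
      have "C *\<^sub>v v = A *\<^sub>v v + ((- \<mu>) \<cdot>\<^sub>m 1\<^sub>m n) *\<^sub>v v"
        unfolding C_def char_matrix_def using A v by (subst add_mult_distrib_mat_vec[of _ n n]) auto
      also have "((- \<mu>) \<cdot>\<^sub>m 1\<^sub>m n) *\<^sub>v v = (- \<mu>) \<cdot>\<^sub>v v"
        using v by (intro eq_vecI) (auto simp: scalar_prod_def if_distrib if_distribR cong: if_cong)
      also have "A *\<^sub>v v + (- \<mu>) \<cdot>\<^sub>v v = A *\<^sub>v v - \<mu> \<cdot>\<^sub>v v"
        using v A by (intro eq_vecI) auto
      finally show ?thesis .
    qed
    have q: "scalar_prod v (C *\<^sub>v v) = scalar_prod v (A *\<^sub>v v) - \<mu> * scalar_prod v v"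
      if v: "v \<in> carrier_vec n" for v
      using v A by (simp add: Cv scalar_prod_minus_distrib[of _ n])
    have q0: "0 \<le> scalar_prod v (C *\<^sub>v v)" if "v \<in> carrier_vec n" for v
      using low[OF that] q[OF that] by simp
    have Csym: "scalar_prod v (C *\<^sub>v w) = scalar_prod (C *\<^sub>v v) w"
      if "v \<in> carrier_vec n" "w \<in> carrier_vec n" for v w
    proof -
      have "scalar_prod v (A *\<^sub>v w) = scalar_prod (A *\<^sub>v v) w"
        using transpose_vec_mult_scalar[OF A that(2,1)] by (simp add: sym)
      then show ?thesis using that A
        by (simp add: Cv scalar_prod_minus_distrib[of _ n] minus_scalar_prod_distrib[of _ n])
    qed
    obtain c where c: "0 < c" "\<And>v. v \<in> carrier_vec n \<Longrightarrow> scalar_prod v (C *\<^sub>v v) \<le> c * scalar_prod v v"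
      using quadratic_form_upper_bound[OF C] by blast
    \<comment> \<open>A Cauchy-Schwarz estimate that passes from the form to the norm of
      \<open>C v\<close>: with \<open>z = C v\<close> and \<open>s = 1 / c\<close>, nonnegativity of
      the form at \<open>v - s z\<close> is combined with its upper bound at
      \<open>z\<close>.\<close>
    have CC: "scalar_prod (C *\<^sub>v v) (C *\<^sub>v v) \<le> c * scalar_prod v (C *\<^sub>v v)" if v: "v \<in> carrier_vec n" for v
    proof -
      define z where "z = C *\<^sub>v v"
      have z: "z \<in> carrier_vec n" using C v by (simp add: z_def)
      define s where "s = 1 / c"
      have Cz: "C *\<^sub>v z \<in> carrier_vec n" using C z by simp
      have "C *\<^sub>v (v - s \<cdot>\<^sub>v z) = z - s \<cdot>\<^sub>v (C *\<^sub>v z)"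
        using v z C by (simp add: mult_minus_distrib_mat_vec[OF C] mult_mat_vec[OF C] z_def)
      then have "scalar_prod (v - s \<cdot>\<^sub>v z) (C *\<^sub>v (v - s \<cdot>\<^sub>v z))
        = scalar_prod v z - s * scalar_prod v (C *\<^sub>v z) - s * (scalar_prod z z - s * scalar_prod z (C *\<^sub>v z))"
        using v z Cz by (simp add: scalar_prod_minus_distrib[of _ n] minus_scalar_prod_distrib[of _ n] algebra_simps)
      moreover have "scalar_prod v (C *\<^sub>v z) = scalar_prod z z" using Csym[OF v z] by (simp add: z_def)
      moreover have "0 \<le> scalar_prod (v - s \<cdot>\<^sub>v z) (C *\<^sub>v (v - s \<cdot>\<^sub>v z))" using v z by (intro q0) auto
      ultimately have "0 \<le> scalar_prod v z - 2 * s * scalar_prod z z + s * s * scalar_prod z (C *\<^sub>v z)"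
        by (simp add: algebra_simps)
      also have "s * s * scalar_prod z (C *\<^sub>v z) \<le> s * s * (c * scalar_prod z z)"
        by (intro mult_left_mono c z) auto
      also have "s * s * (c * scalar_prod z z) = s * scalar_prod z z" using c by (simp add: s_def)
      finally have "s * scalar_prod z z \<le> scalar_prod v z" by simp
      then show ?thesis using c by (simp add: s_def z_def field_simps)
    qed
    obtain d where d: "0 < d"
      "\<And>v. v \<in> carrier_vec n \<Longrightarrow> scalar_prod v ((transpose_mat D * D) *\<^sub>v v) \<le> d * scalar_prod v v"
      using quadratic_form_upper_bound[of "transpose_mat D * D" n] D by auto
    have "1 / (d * c) + \<mu> \<le> r" if r: "r \<in> R" for r
    proof -
      obtain v where v: "v \<in> carrier_vec n" "scalar_prod v v = 1" "r = scalar_prod v (A *\<^sub>v v)"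
        using r unfolding R_def by blast
      define z where "z = C *\<^sub>v v"
      have z: "z \<in> carrier_vec n" using C v by (simp add: z_def)
      \<comment> \<open>Since \<open>D\<close> inverts \<open>C\<close>, a vector of length 1 cannot
        have an arbitrarily small image \<open>z\<close>; hence all values in \<open>R\<close>
        exceed their infimum by a fixed positive amount.\<close>
      have "D *\<^sub>v z = v" using assoc_mult_mat_vec[OF D(1) C v(1)] D v by (simp add: z_def)
      then have "1 = scalar_prod (D *\<^sub>v z) (D *\<^sub>v z)" using v by simp
      also have "\<dots> = scalar_prod z ((transpose_mat D * D) *\<^sub>v z)"
        using transpose_vec_mult_scalar[of "transpose_mat D" n n "D *\<^sub>v z" z] D z
          assoc_mult_mat_vec[of "transpose_mat D" n n D n z] by simp
      also have "\<dots> \<le> d * scalar_prod z z" by (rule d(2)[OF z])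
      also have "\<dots> \<le> d * (c * scalar_prod v (C *\<^sub>v v))"
        using CC[OF v(1)] d(1) by (simp add: z_def)
      also have "scalar_prod v (C *\<^sub>v v) = r - \<mu>" using q[OF v(1)] v by simp
      finally show ?thesis using c d by (simp add: field_simps)
    qed
    then have "1 / (d * c) + \<mu> \<le> \<mu>"
      unfolding \<mu>_def using \<open>R \<noteq> {}\<close> by (intro cInf_greatest) auto
    then show False using mult_pos_pos[OF d(1) c(1)] by simp
  qed
  with low show ?thesis by blast
qed

lemma maximal_eigenvalue:
  fixes A :: "real Matrix.mat"
  assumes A: "A \<in> carrier_mat n n" and sym: "transpose_mat A = A" and n: "0 < n"
  shows "\<exists>\<mu>\<in>spectrum A. \<forall>v\<in>carrier_vec n. scalar_prod v (A *\<^sub>v v) \<le> \<mu> * scalar_prod v v"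
proof -
  have "transpose_mat (- A) = - A" using sym by (metis transpose_uminus)
  with minimal_eigenvalue[of "- A" n] A n obtain \<mu> where \<mu>: "\<mu> \<in> spectrum (- A)"
    "\<forall>v\<in>carrier_vec n. \<mu> * scalar_prod v v \<le> scalar_prod v ((- A) *\<^sub>v v)" by auto
  from \<mu>(1) obtain v where v: "v \<in> carrier_vec n" "v \<noteq> 0\<^sub>v n" "(- A) *\<^sub>v v = \<mu> \<cdot>\<^sub>v v"
    using A by (auto simp: spectrum_def eigenvalue_def eigenvector_def)
  have "A *\<^sub>v v = - ((- A) *\<^sub>v v)" using A v(1) by simp
  also have "\<dots> = (- \<mu>) \<cdot>\<^sub>v v" unfolding v(3) by (intro eq_vecI) auto
  finally have "- \<mu> \<in> spectrum A"
    using A v by (auto simp: spectrum_def eigenvalue_def eigenvector_def)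
  moreover have "scalar_prod v (A *\<^sub>v v) \<le> (- \<mu>) * scalar_prod v v" if "v \<in> carrier_vec n" for v
    using \<mu>(2) that A by fastforce
  ultimately show ?thesis by blast
qed

text \<open>Two estimates for all vectors confine the spectrum, and two test vectors push its ends
  apart, so no eigenvector has to be known. Positivity of \<open>lo\<close> keeps the denominators
  positive.\<close>

lemma cond_number_bounds:
  fixes A :: "real Matrix.mat"
  assumes A: "A \<in> carrier_mat n n" and sym: "transpose_mat A = A" and n: "0 < n"
    and lo: "0 < lo" "\<And>v. v \<in> carrier_vec n \<Longrightarrow> lo * scalar_prod v v \<le> scalar_prod v (A *\<^sub>v v)"
    and hi: "\<And>v. v \<in> carrier_vec n \<Longrightarrow> scalar_prod v (A *\<^sub>v v) \<le> hi * scalar_prod v v"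
    and small: "v \<in> carrier_vec n" "v \<noteq> 0\<^sub>v n" "scalar_prod v (A *\<^sub>v v) \<le> m * scalar_prod v v"
    and large: "w \<in> carrier_vec n" "w \<noteq> 0\<^sub>v n" "M * scalar_prod w w \<le> scalar_prod w (A *\<^sub>v w)" "0 \<le> M"
  shows "M / m \<le> cond_number A" "cond_number A \<le> hi / lo"
proof -
  let ?S = "spectrum A"
  have fin: "finite ?S" by (rule card_finite_spectrum[OF A])
  have ev: "lo \<le> k \<and> k \<le> hi" if k: "k \<in> ?S" for k
  proof -
    obtain u where u: "u \<in> carrier_vec n" "u \<noteq> 0\<^sub>v n" "A *\<^sub>v u = k \<cdot>\<^sub>v u"
      using k A by (auto simp: spectrum_def eigenvalue_def eigenvector_def)
    have "0 < scalar_prod u u" by (rule scalar_prod_self_pos[OF u(1,2)])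
    with lo(2)[OF u(1)] hi[OF u(1)] u show ?thesis by simp
  qed
  obtain k where k: "k \<in> ?S" "k * scalar_prod v v \<le> scalar_prod v (A *\<^sub>v v)"
    using minimal_eigenvalue[OF A sym n] small(1) by blast
  obtain k' where k': "k' \<in> ?S" "scalar_prod w (A *\<^sub>v w) \<le> k' * scalar_prod w w"
    using maximal_eigenvalue[OF A sym n] large(1) by blast
  have "k \<le> m" using k(2) small(3) scalar_prod_self_pos[OF small(1,2)]
    by (meson mult_le_cancel_right_pos order_trans)
  have "M \<le> k'" using k'(2) large(3) scalar_prod_self_pos[OF large(1,2)]
    by (meson mult_le_cancel_right_pos order_trans)
  have ne: "?S \<noteq> {}" using k by auto
  have Min: "Min ?S \<in> ?S" "Min ?S \<le> m"
    by (rule Min_in[OF fin ne], rule order_trans[OF Min_le[OF fin k(1)] \<open>k \<le> m\<close>])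
  have Max: "Max ?S \<in> ?S" "M \<le> Max ?S"
    by (rule Max_in[OF fin ne], rule order_trans[OF \<open>M \<le> k'\<close> Max_ge[OF fin k'(1)]])
  show "M / m \<le> cond_number A"
    unfolding cond_number_def using ev[OF Min(1)] Min(2) Max(2) lo(1) large(4) by (intro frac_le) auto
  show "cond_number A \<le> hi / lo"
    unfolding cond_number_def using ev[OF Min(1)] ev[OF Max(1)] lo(1) by (intro frac_le) auto
qed

section \<open>The quadratic form of the kernel\<close>

text \<open>The midpoint rule underestimates the integral of the convex function \<open>t powr (- p - 1)\<close>.\<close>

lemma powr_midpoint:
  fixes p x :: real
  assumes p: "0 < p" and x: "0 < x"
  shows "p * (x + 1/2) powr (- p - 1) \<le> x powr (- p) - (x + 1) powr (- p)"
proof -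
  define c where "c = x + 1/2"
  \<comment> \<open>\<open>D u\<close> is the integral of \<open>p * t powr (- p - 1)\<close> over
    \<open>[c - u, c + u]\<close> minus the midpoint value times the length. As
    \<open>D 0 = 0\<close>, monotonicity is all that is to be shown.\<close>
  define D where "D u = (c - u) powr (- p) - (c + u) powr (- p) - 2 * u * p * c powr (- p - 1)" for u
  have "D 0 \<le> D (1/2)"
  proof (rule DERIV_nonneg_imp_nondecreasing[of 0 "1/2" D])
    fix u :: real assume u: "0 \<le> u" "u \<le> 1/2"
    have pos: "0 < c - u" "0 < c + u" "0 < c" using u x by (auto simp: c_def)
    \<comment> \<open>Halving the exponent turns the end point values into squares, so that
      \<open>\<alpha>^2 + \<beta>^2 >= 2 \<alpha> \<beta>\<close> applies; and
      \<open>\<alpha> \<beta>\<close> is a negative power of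
      \<open>c^2 - u^2 <= c^2\<close>.\<close>
    define r where "r = (p + 1) / 2"
    have r: "- r + - r = - p - 1" by (simp add: r_def field_simps)
    define \<alpha> \<beta> where "\<alpha> = (c - u) powr (- r)" and "\<beta> = (c + u) powr (- r)"
    have "(D has_real_derivative p * (\<alpha>\<^sup>2 + \<beta>\<^sup>2 - 2 * c powr (- p - 1))) (at u)"
    proof -
      have sq: "\<alpha>\<^sup>2 = (c - u) powr (- p - 1)" "\<beta>\<^sup>2 = (c + u) powr (- p - 1)"
        unfolding \<alpha>_def \<beta>_def power2_eq_square powr_add[symmetric] r by simp_all
      show ?thesis unfolding D_def sq
        using pos by (auto intro!: derivative_eq_intros simp: algebra_simps)
    qed
    moreover have "0 \<le> p * (\<alpha>\<^sup>2 + \<beta>\<^sup>2 - 2 * c powr (- p - 1))"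
    proof -
      have "c powr (- p - 1) = (c * c) powr (- r)"
        using pos by (simp only: powr_mult powr_add[symmetric] r)
      also have "\<dots> \<le> ((c - u) * (c + u)) powr (- r)"
        using p mult_pos_pos[OF pos(1,2)] by (intro powr_mono2') (auto simp: r_def algebra_simps)
      also have "\<dots> = \<alpha> * \<beta>" using pos by (simp add: powr_mult \<alpha>_def \<beta>_def)
      finally have "2 * c powr (- p - 1) \<le> \<alpha>\<^sup>2 + \<beta>\<^sup>2"
        using sum_squares_bound[of \<alpha> \<beta>] by simp
      then show ?thesis using p by simp
    qed
    ultimately show "\<exists>y. (D has_real_derivative y) (at u) \<and> 0 \<le> y" by blast
  qed simp
  then show ?thesis by (simp add: D_def c_def algebra_simps)
qed

text \<open>The shift 1/2 in the kernel coefficients makes \<open>l + k + 1/2\<close> the midpoint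
  of \<open>[l + k, l + k + 1]\<close>, so the midpoint rule telescopes without a separate first
  term.\<close>

lemma powr_tail_bound:
  assumes s: "1 < s" and k: "1 \<le> k"
  shows "summable (\<lambda>l. (real (l + k) + 1/2) powr (1 - 2 * s))"
    and "(\<Sum>l. (real (l + k) + 1/2) powr (1 - 2 * s)) \<le> real k powr (2 - 2 * s) / (2 * (s - 1))"
proof -
  define p where "p = 2 * s - 2"
  have p: "0 < p" using s by (simp add: p_def)
  define b where "b l = real (l + k) powr (- p) / p" for l
  have le: "(real (l + k) + 1/2) powr (1 - 2 * s) \<le> b l - b (Suc l)" for l
  proof -
    have "p * (real (l + k) + 1/2) powr (- p - 1) \<le> real (l + k) powr (- p) - (real (l + k) + 1) powr (- p)"
      using k by (intro powr_midpoint p) simp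
    moreover have "- p - 1 = 1 - 2 * s" by (simp add: p_def)
    ultimately show ?thesis using p by (simp add: b_def field_simps)
  qed
  have "b \<longlonglongrightarrow> 0 / p"
    unfolding b_def
  proof (intro tendsto_divide tendsto_const)
    have "filterlim (\<lambda>l. real (l + k)) at_top sequentially"
      by (rule filterlim_subseq[THEN filterlim_compose[OF filterlim_real_sequentially]]) (simp add: strict_mono_def)
    then show "(\<lambda>l. real (l + k) powr (- p)) \<longlonglongrightarrow> 0"
      using p by (intro tendsto_neg_powr) auto
  qed (use p in simp)
  then have tele: "(\<lambda>l. b l - b (Suc l)) sums b 0"
    using telescope_sums'[of b 0] by simp
  show S: "summable (\<lambda>l. (real (l + k) + 1/2) powr (1 - 2 * s))"
    by (rule summable_comparison_test'[OF sums_summable[OF tele]]) (use le in simp)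
  have "(\<Sum>l. (real (l + k) + 1/2) powr (1 - 2 * s)) \<le> b 0"
    unfolding sums_unique[OF tele] by (intro suminf_le le S sums_summable[OF tele])
  also have "\<dots> = real k powr (2 - 2 * s) / (2 * (s - 1))" by (simp add: b_def p_def algebra_simps)
  finally show "(\<Sum>l. (real (l + k) + 1/2) powr (1 - 2 * s)) \<le> real k powr (2 - 2 * s) / (2 * (s - 1))" .
qed

definition kernel_weight :: "real \<Rightarrow> nat \<Rightarrow> real" where
  "kernel_weight s l = (2 * real l + 1) / (4 * pi) * kernel_coeff s l"

lemma kernel_weight_eq: "kernel_weight s l = (real l + 1/2) powr (1 - 2 * s) / (2 * pi)"
proof -
  have "(real l + 1/2) powr (1 - 2 * s) = (real l + 1/2) powr 1 * (real l + 1/2) powr (- 2 * s)"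
    unfolding powr_add[symmetric] by simp
  also have "(real l + 1/2) powr 1 = real l + 1/2" by simp
  finally have "(real l + 1/2) powr (1 - 2 * s) = (real l + 1/2) * (real l + 1/2) powr (- 2 * s)" .
  moreover have "(2 * real l + 1) / (4 * pi) = (real l + 1/2) / (2 * pi)" by (simp add: field_simps)
  ultimately show ?thesis
    by (simp only: kernel_weight_def kernel_coeff_def times_divide_eq_left)
qed

lemma kernel_weight_pos: "0 < kernel_weight s l"
  unfolding kernel_weight_eq by (auto intro!: divide_pos_pos)

lemma kernel_weight_tail:
  assumes "1 < s" "1 \<le> k"
  shows "summable (\<lambda>l. kernel_weight s (l + k))"
    and "(\<Sum>l. kernel_weight s (l + k)) \<le> real k powr (2 - 2 * s) / (4 * pi * (s - 1))"
proof -
  show "summable (\<lambda>l. kernel_weight s (l + k))"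
    unfolding kernel_weight_eq by (intro summable_divide powr_tail_bound assms)
  have "(\<Sum>l. kernel_weight s (l + k)) = (\<Sum>l. (real (l + k) + 1/2) powr (1 - 2 * s)) / (2 * pi)"
    unfolding kernel_weight_eq by (intro suminf_divide powr_tail_bound assms)
  also have "\<dots> \<le> real k powr (2 - 2 * s) / (2 * (s - 1)) / (2 * pi)"
    by (intro divide_right_mono powr_tail_bound assms) auto
  finally show "(\<Sum>l. kernel_weight s (l + k)) \<le> real k powr (2 - 2 * s) / (4 * pi * (s - 1))"
    by (simp add: algebra_simps)
qed

section \<open>From coefficient sums to bounds on the form\<close>

definition legendre_form :: "nat \<Rightarrow> (nat \<Rightarrow> real^3) \<Rightarrow> nat \<Rightarrow> (nat \<Rightarrow> real) \<Rightarrow> real" where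
  "legendre_form N x l v = (\<Sum>i<N. \<Sum>j<N. v i * v j * poly (legendre l) (inner (x i) (x j)))"

definition kernel_form :: "nat \<Rightarrow> (nat \<Rightarrow> real^3) \<Rightarrow> real \<Rightarrow> (nat \<Rightarrow> real) \<Rightarrow> real" where
  "kernel_form N x s v = (\<Sum>i<N. \<Sum>j<N. v i * v j * discrepancy_kernel s (x i) (x j))"

lemma sum_abs_squared_le: "(\<Sum>i<N. \<bar>v i\<bar>)\<^sup>2 \<le> real N * (\<Sum>i<N. (v i)\<^sup>2)" for v :: "nat \<Rightarrow> real"
  using sum_squared_le_sum_of_squares[of "\<lambda>i. \<bar>v i\<bar>" "{..<N}"] by (simp add: mult.commute)

lemma legendre_form_bounds:
  assumes "\<And>i. i < N \<Longrightarrow> norm (x i) = 1"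
  shows "0 \<le> legendre_form N x l v" "legendre_form N x l v \<le> real N * (\<Sum>i<N. (v i)\<^sup>2)"
proof -
  show "0 \<le> legendre_form N x l v"
    unfolding legendre_form_def by (rule legendre_positive_definite) (simp add: assms)
  have "legendre_form N x l v \<le> (\<Sum>i<N. \<Sum>j<N. \<bar>v i\<bar> * \<bar>v j\<bar>)"
    unfolding legendre_form_def
  proof (intro sum_mono)
    fix i j assume ij: "i \<in> {..<N}" "j \<in> {..<N}"
    have "\<bar>poly (legendre l) (inner (x i) (x j))\<bar> \<le> 1"
      using ij assms by (intro abs_legendre_le_1 abs_inner_unit) auto
    then have "\<bar>v i * v j * poly (legendre l) (inner (x i) (x j))\<bar> \<le> \<bar>v i * v j\<bar>"
      by (simp add: abs_mult mult_left_le)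
    from order_trans[OF abs_ge_self this]
    show "v i * v j * poly (legendre l) (inner (x i) (x j)) \<le> \<bar>v i\<bar> * \<bar>v j\<bar>"
      by (simp add: abs_mult)
  qed
  also have "\<dots> = (\<Sum>i<N. \<bar>v i\<bar>)\<^sup>2" by (simp add: power2_eq_square sum_product)
  also have "\<dots> \<le> real N * (\<Sum>i<N. (v i)\<^sup>2)" by (rule sum_abs_squared_le)
  finally show "legendre_form N x l v \<le> real N * (\<Sum>i<N. (v i)\<^sup>2)" .
qed

lemma discrepancy_kernel_sums:
  assumes "1 < s" "norm x = 1" "norm y = 1"
  shows "(\<lambda>l. kernel_weight s (Suc l) * poly (legendre (Suc l)) (inner x y)) sums discrepancy_kernel s x y"
proof -
  have "summable (\<lambda>l. kernel_weight s (Suc l) * poly (legendre (Suc l)) (inner x y))"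
  proof (rule summable_comparison_test')
    show "summable (\<lambda>l. kernel_weight s (Suc l))" using kernel_weight_tail(1)[OF assms(1), of 1] by simp
    show "norm (kernel_weight s (Suc l) * poly (legendre (Suc l)) (inner x y)) \<le> kernel_weight s (Suc l)" if "0 \<le> l" for l
      using abs_legendre_le_1[OF abs_inner_unit[OF assms(2,3)], of "Suc l"] kernel_weight_pos[of s "Suc l"]
      by (simp add: abs_mult mult_left_le)
  qed
  then show ?thesis
    unfolding discrepancy_kernel_def Let_def kernel_weight_def[symmetric] by (rule summable_sums)
qed

lemma kernel_form_sums:
  assumes "1 < s" "\<And>i. i < N \<Longrightarrow> norm (x i) = 1"
  shows "(\<lambda>l. kernel_weight s (Suc l) * legendre_form N x (Suc l) v) sums kernel_form N x s v"
proof -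
  have "(\<lambda>l. \<Sum>i<N. \<Sum>j<N. v i * v j * (kernel_weight s (Suc l) * poly (legendre (Suc l)) (inner (x i) (x j))))
      sums kernel_form N x s v"
    unfolding kernel_form_def
    by (intro sums_sum sums_mult discrepancy_kernel_sums assms) auto
  then show ?thesis by (simp add: legendre_form_def sum_distrib_left mult_ac)
qed

text \<open>This serves both ends of the spectrum: \<open>k = 1\<close> imposes no condition on
  \<open>v\<close> and bounds the largest eigenvalue, while a vector annihilating the low degrees
  leaves only the tail from \<open>k\<close> on and bounds the smallest one.\<close>

lemma kernel_form_upper_bound:
  assumes s: "1 < s" and x: "\<And>i. i < N \<Longrightarrow> norm (x i) = 1" and k: "1 \<le> k"
    and zero: "\<And>l. l < k \<Longrightarrow> 1 \<le> l \<Longrightarrow> legendre_form N x l v = 0"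
  shows "kernel_form N x s v \<le> real N * real k powr (2 - 2 * s) / (4 * pi * (s - 1)) * (\<Sum>i<N. (v i)\<^sup>2)"
proof -
  define f where "f l = kernel_weight s (Suc l) * legendre_form N x (Suc l) v" for l
  define B where "B = real N * (\<Sum>i<N. (v i)\<^sup>2)"
  have "f sums kernel_form N x s v" unfolding f_def by (rule kernel_form_sums[OF s x])
  \<comment> \<open>\<open>f\<close> starts with degree 1, so the degrees below \<open>k\<close> are
    its first \<open>k - 1\<close> terms.\<close>
  then have "(\<lambda>l. f (l + (k - 1))) sums (kernel_form N x s v - (\<Sum>l<k - 1. f l))"
    by (rule sums_split_initial_segment)
  moreover have "(\<Sum>l<k - 1. f l) = 0"
    by (intro sum.neutral) (auto simp: f_def zero)
  ultimately have 1: "(\<lambda>l. f (l + (k - 1))) sums kernel_form N x s v" by simp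
  have "kernel_form N x s v \<le> (\<Sum>l. kernel_weight s (l + k)) * B"
  proof (rule sums_le[OF _ 1])
    show "(\<lambda>l. kernel_weight s (l + k) * B) sums ((\<Sum>l. kernel_weight s (l + k)) * B)"
      by (intro sums_mult2 summable_sums kernel_weight_tail s k)
    show "f (l + (k - 1)) \<le> kernel_weight s (l + k) * B" for l
    proof -
      have "Suc (l + (k - 1)) = l + k" using k by simp
      then show ?thesis
        using legendre_form_bounds(2)[OF x, where l = "l + k" and v = v] kernel_weight_pos[of s "l + k"]
        by (simp add: f_def B_def)
    qed
  qed
  also have "\<dots> \<le> real k powr (2 - 2 * s) / (4 * pi * (s - 1)) * B"
    by (intro mult_right_mono kernel_weight_tail s k) (auto simp: B_def intro!: mult_nonneg_nonneg sum_nonneg)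
  finally show ?thesis by (simp add: B_def mult_ac)
qed

lemma kernel_form_partial_sum:
  assumes s: "1 < s" and x: "\<And>i. i < N \<Longrightarrow> norm (x i) = 1"
  shows "(\<Sum>l=1..n. kernel_weight s l * legendre_form N x l v) \<le> kernel_form N x s v"
proof -
  have "(\<Sum>l<n. kernel_weight s (Suc l) * legendre_form N x (Suc l) v)
      \<le> (\<Sum>l. kernel_weight s (Suc l) * legendre_form N x (Suc l) v)"
  proof (rule sum_le_suminf)
    show "summable (\<lambda>l. kernel_weight s (Suc l) * legendre_form N x (Suc l) v)"
      by (rule sums_summable[OF kernel_form_sums[OF s x]])
    show "0 \<le> kernel_weight s (Suc l) * legendre_form N x (Suc l) v" for l
      by (rule mult_nonneg_nonneg[OF less_imp_le[OF kernel_weight_pos] legendre_form_bounds(1)[OF x]])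
  qed simp
  also have "\<dots> = kernel_form N x s v"
    using sums_unique[OF kernel_form_sums[OF s x]] by simp
  finally have "(\<Sum>l<n. kernel_weight s (Suc l) * legendre_form N x (Suc l) v) \<le> kernel_form N x s v" .
  moreover have "(\<Sum>l=1..n. kernel_weight s l * legendre_form N x l v)
     = (\<Sum>l<n. kernel_weight s (Suc l) * legendre_form N x (Suc l) v)"
    by (simp add: sum.atLeast1_atMost_eq)
  ultimately show ?thesis by simp
qed

section \<open>Fejer kernels\<close>

text \<open>At \<open>cos u\<close> this is \<open>(1 - cos (n u)) / (1 - cos u)\<close>, the
  unnormalized Fejer kernel. The recurrence, which comes from the addition formula for cosines,
  exhibits it as a polynomial in the cosine without an exception at \<open>u = 0\<close>.\<close>

fun fejer :: "nat \<Rightarrow> real poly" where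
  "fejer 0 = 0"
| "fejer (Suc 0) = 1"
| "fejer (Suc (Suc n)) = [:0, 2:] * fejer (Suc n) - fejer n + [:2:]"

lemma degree_fejer: "degree (fejer n) \<le> n - 1"
proof (induction n rule: fejer.induct)
  case (3 n)
  have "degree ([:0, 2:] * fejer (Suc n)) \<le> Suc n"
    using degree_mult_le[of "[:0, 2:]" "fejer (Suc n)"] 3 by simp
  moreover have "degree (fejer n) \<le> Suc n" using 3 by simp
  ultimately have "degree ([:0, 2:] * fejer (Suc n) - fejer n + [:2:]) \<le> Suc n"
    by (intro degree_add_le degree_diff_le) auto
  then show ?case by simp
qed simp_all

lemma fejer_at_1: "poly (fejer n) 1 = (real n)\<^sup>2"
  by (induction n rule: fejer.induct) (auto simp: power2_eq_square algebra_simps)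

lemma fejer_cos: "poly (fejer n) (cos u) * (1 - cos u) = 1 - cos (real n * u)"
proof (induction n rule: fejer.induct)
  case (3 n)
  have c: "cos (real (Suc (Suc n)) * u) = 2 * cos u * cos (real (Suc n) * u) - cos (real n * u)"
  proof -
    have "cos (real (Suc n) * u + u) + cos (real (Suc n) * u - u) = 2 * cos u * cos (real (Suc n) * u)"
      by (simp only: cos_add cos_diff) (simp add: algebra_simps)
    moreover have "real (Suc n) * u + u = real (Suc (Suc n)) * u" "real (Suc n) * u - u = real n * u"
      by (simp_all add: algebra_simps)
    ultimately show ?thesis by simp
  qed
  have "poly (fejer (Suc (Suc n))) (cos u) * (1 - cos u)
    = 2 * cos u * (poly (fejer (Suc n)) (cos u) * (1 - cos u)) - poly (fejer n) (cos u) * (1 - cos u) + 2 * (1 - cos u)"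
    by (simp add: algebra_simps)
  also have "\<dots> = 1 - cos (real (Suc (Suc n)) * u)"
    unfolding 3 c by (simp add: algebra_simps)
  finally show ?case .
qed simp_all

lemma abs_sin_mult_le: "\<bar>sin (real n * u)\<bar> \<le> real n * \<bar>sin u\<bar>"
proof (induction n)
  case (Suc n)
  have "sin (real (Suc n) * u) = sin (real n * u) * cos u + cos (real n * u) * sin u"
  proof -
    have "real (Suc n) * u = real n * u + u" by (simp add: algebra_simps)
    then show ?thesis by (simp only: sin_add)
  qed
  also have "\<bar>\<dots>\<bar> \<le> \<bar>sin (real n * u)\<bar> * 1 + 1 * \<bar>sin u\<bar>"
    by (rule order_trans[OF abs_triangle_ineq]) (auto simp: abs_mult intro!: add_mono mult_left_le mult_left_le_one_le)
  also have "\<dots> \<le> real (Suc n) * \<bar>sin u\<bar>" using Suc by (simp add: algebra_simps)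
  finally show ?case .
qed simp

text \<open>The second bound governs the peak at 1, the third the decay away from it. The first two
  are obtained after multiplication with \<open>1 - t\<close>, so at \<open>t = 1\<close> the
  explicit value is used.\<close>

lemma fejer_bounds:
  assumes "-1 \<le> t" "t \<le> 1"
  shows "0 \<le> poly (fejer n) t" "poly (fejer n) t \<le> (real n)\<^sup>2" "poly (fejer n) t * (1 - t) \<le> 2"
proof -
  define u where "u = arccos t"
  have t: "t = cos u" using assms by (simp add: u_def)
  have eq: "poly (fejer n) t * (1 - t) = 1 - cos (real n * u)" unfolding t by (rule fejer_cos)
  show "poly (fejer n) t * (1 - t) \<le> 2" unfolding eq using cos_ge_minus_one[of "real n * u"] by simp
  have cos_sin: "1 - cos x = 2 * (sin (x / 2))\<^sup>2" for x :: real
    using cos_double_sin[of "x / 2"] by simp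
  have "(sin (real n * (u / 2)))\<^sup>2 \<le> (real n * sin (u / 2))\<^sup>2"
    using abs_sin_mult_le[of n "u / 2"] by (simp add: abs_le_square_iff[symmetric] abs_mult)
  then have "1 - cos (real n * u) \<le> (real n)\<^sup>2 * (1 - cos u)"
    unfolding cos_sin by (simp add: power_mult_distrib)
  then have le: "poly (fejer n) t * (1 - t) \<le> (real n)\<^sup>2 * (1 - t)" unfolding eq by (simp only: t)
  have ge: "0 \<le> poly (fejer n) t * (1 - t)" unfolding eq by simp
  show "0 \<le> poly (fejer n) t"
    using ge assms by (cases "t = 1") (auto simp: fejer_at_1 zero_le_mult_iff)
  show "poly (fejer n) t \<le> (real n)\<^sup>2"
    using le assms by (cases "t = 1") (auto simp: fejer_at_1)
qed

text \<open>The bound is of order \<open>m^2\<close>, while the polynomial has the value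
  \<open>m^4\<close> at 1; this gap is what the comparison with the kernel exploits.\<close>

lemma legendre_coeff_fejer_sq_le:
  assumes m: "0 < m"
  shows "legendre_coeff ((fejer m)\<^sup>2) l \<le> 4 * (real m)\<^sup>2"
proof -
  \<comment> \<open>For this \<open>d\<close> the two bounds of the Fejer kernel add up to
    \<open>?f * (d + 1 - t) <= 2 + 2\<close>, whence the 16 in \<open>?g\<close> and the bound
    \<open>16 / d = 8 m^2\<close> of the integral.\<close>
  define d where "d = 2 / (real m)\<^sup>2"
  have d: "0 < d" using m by (simp add: d_def)
  let ?g = "\<lambda>t. 16 * (1 / (d + 1 - t)\<^sup>2)"
  have gint: "(?g has_integral 16 * (1 / d - 1 / (d + 2))) {-1..1}"
    by (rule has_integral_mult_right[OF inverse_square_integral[OF d]])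
  have "integral {-1..1} (\<lambda>t. poly ((fejer m)\<^sup>2) t * poly (legendre l) t) \<le> integral {-1..1} ?g"
  proof (rule integral_le)
    show "(\<lambda>t. poly ((fejer m)\<^sup>2) t * poly (legendre l) t) integrable_on {-1..1}"
      unfolding poly_mult[symmetric] by (rule poly_integrable)
    show "?g integrable_on {-1..1}" using gint by blast
    fix t :: real assume t: "t \<in> {-1..1}"
    let ?f = "poly (fejer m) t"
    have f: "0 \<le> ?f" "?f \<le> (real m)\<^sup>2" "?f * (1 - t) \<le> 2" using fejer_bounds t by auto
    have pos: "0 < d + 1 - t" using d t by auto
    have "?f * d \<le> 2" using f(2) m by (simp add: d_def field_simps)
    with f(3) have "?f * (d + 1 - t) \<le> 4" by (simp add: algebra_simps)
    then have "(?f * (d + 1 - t))\<^sup>2 \<le> 4\<^sup>2" using f(1) pos by (intro power_mono) auto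
    then have "?f\<^sup>2 * (d + 1 - t)\<^sup>2 \<le> 16" by (simp add: power_mult_distrib)
    moreover have "0 < (d + 1 - t)\<^sup>2" using pos by simp
    ultimately have "?f\<^sup>2 \<le> ?g t" by (simp add: pos_le_divide_eq)
    moreover have "?f\<^sup>2 * poly (legendre l) t \<le> ?f\<^sup>2 * 1"
      using abs_legendre_le_1[of t l] t by (intro mult_left_mono) (auto simp: abs_le_iff)
    ultimately show "poly ((fejer m)\<^sup>2) t * poly (legendre l) t \<le> ?g t" by simp
  qed
  also have "\<dots> = 16 * (1 / d - 1 / (d + 2))" by (rule integral_unique[OF gint])
  also have "\<dots> \<le> 16 * (1 / d)" using d by simp
  also have "\<dots> = 8 * (real m)\<^sup>2" using m by (simp add: d_def)
  finally show ?thesis by (simp add: legendre_coeff_def)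
qed

text \<open>A Gershgorin estimate for forms: for nonnegative entries
  \<open>(v i + v j)^2 >= 0\<close> bounds each off-diagonal term by half the squares of both
  indices, and symmetry collects these into row sums.\<close>

lemma diagonally_dominant_form:
  fixes K :: "nat \<Rightarrow> nat \<Rightarrow> real"
  assumes diag: "\<And>i. i < N \<Longrightarrow> K i i = d"
    and sym: "\<And>i j. K i j = K j i"
    and nonneg: "\<And>i j. i < N \<Longrightarrow> j < N \<Longrightarrow> 0 \<le> K i j"
    and off: "\<And>i. i < N \<Longrightarrow> (\<Sum>j\<in>{..<N} - {i}. K i j) \<le> b"
  shows "(d - b) * (\<Sum>i<N. (v i)\<^sup>2) \<le> (\<Sum>i<N. \<Sum>j<N. v i * v j * K i j)"
proof -
  define K' where "K' i j = (if i = j then 0 else K i j)" for i j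
  have "(\<Sum>i<N. \<Sum>j<N. v i * v j * K i j) = (\<Sum>i<N. \<Sum>j<N. (if i = j then d * (v i)\<^sup>2 else 0) + v i * v j * K' i j)"
    by (intro sum.cong refl) (auto simp: K'_def diag power2_eq_square)
  also have "\<dots> = (\<Sum>i<N. d * (v i)\<^sup>2) + (\<Sum>i<N. \<Sum>j<N. v i * v j * K' i j)"
    by (simp add: sum.distrib)
  finally have eq: "(\<Sum>i<N. \<Sum>j<N. v i * v j * K i j) = d * (\<Sum>i<N. (v i)\<^sup>2) + (\<Sum>i<N. \<Sum>j<N. v i * v j * K' i j)"
    by (simp add: sum_distrib_left)
  have "- (\<Sum>i<N. \<Sum>j<N. v i * v j * K' i j) \<le> (\<Sum>i<N. \<Sum>j<N. (v i)\<^sup>2 * K' i j / 2 + (v j)\<^sup>2 * K' j i / 2)"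
    unfolding sum_negf[symmetric]
  proof (intro sum_mono)
    fix i j assume "i \<in> {..<N}" "j \<in> {..<N}"
    then have k: "0 \<le> K' i j" "K' j i = K' i j" using nonneg sym by (auto simp: K'_def)
    have "0 \<le> (v i + v j)\<^sup>2 * K' i j" using k by simp
    then show "- (v i * v j * K' i j) \<le> (v i)\<^sup>2 * K' i j / 2 + (v j)\<^sup>2 * K' j i / 2"
      unfolding k by (simp add: power2_eq_square algebra_simps)
  qed
  also have "\<dots> = (\<Sum>i<N. \<Sum>j<N. (v i)\<^sup>2 * K' i j / 2) + (\<Sum>j<N. \<Sum>i<N. (v j)\<^sup>2 * K' j i / 2)"
    by (simp only: sum.distrib) (subst (2) sum.swap, rule refl)
  also have "\<dots> = (\<Sum>i<N. (v i)\<^sup>2 * (\<Sum>j<N. K' i j))"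
    by (simp add: sum_distrib_left sum_distrib_right mult_ac flip: sum.distrib)
  also have "\<dots> \<le> (\<Sum>i<N. (v i)\<^sup>2 * b)"
  proof (intro sum_mono mult_left_mono)
    fix i assume i: "i \<in> {..<N}"
    have "(\<Sum>j<N. K' i j) = (\<Sum>j\<in>{..<N} - {i}. K i j)"
      using i by (subst sum.remove[of _ i]) (auto simp: K'_def intro!: sum.cong)
    then show "(\<Sum>j<N. K' i j) \<le> b" using off i by simp
  qed simp
  also have "\<dots> = b * (\<Sum>i<N. (v i)\<^sup>2)" by (simp add: sum_distrib_left mult.commute)
  finally show ?thesis unfolding eq left_diff_distrib by linarith
qed

text \<open>The Fejer kernel is squared because with the decay \<open>4 / (1 - t)^2\<close> the row
  sums have the order \<open>1 / \<rho>^4\<close>, without the logarithm that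
  \<open>2 / (1 - t)\<close> would produce. Subtracted from the diagonal value \<open>m^4\<close>
  are the off-diagonal row sum and the term of degree 0, which the right-hand side lacks.\<close>

lemma legendre_form_lower_bound:
  assumes x: "\<And>i. i < N \<Longrightarrow> norm (x i) = 1" and \<rho>: "0 < \<rho>" "\<rho> \<le> 2"
    and sep: "\<And>i j. i < N \<Longrightarrow> j < N \<Longrightarrow> i \<noteq> j \<Longrightarrow> \<rho> \<le> norm (x i - x j)"
    and m: "0 < m" "2 * m - 2 \<le> L"
  shows "(real m ^ 4 - 1600 / \<rho> ^ 4 - 4 * (real m)\<^sup>2 * real N) * (\<Sum>i<N. (v i)\<^sup>2)
     \<le> 4 * (real m)\<^sup>2 * (\<Sum>l=1..L. (2 * real l + 1) * legendre_form N x l v)"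
proof -
  define p where "p = (fejer m)\<^sup>2"
  define V where "V = (\<Sum>i<N. (v i)\<^sup>2)"
  define c where "c = legendre_coeff p"
  have c: "c l \<le> 4 * (real m)\<^sup>2" for l unfolding c_def p_def by (rule legendre_coeff_fejer_sq_le[OF m(1)])
  have "degree p \<le> 2 * degree (fejer m)"
    unfolding p_def power2_eq_square using degree_mult_le[of "fejer m" "fejer m"] by simp
  then have "degree p \<le> L" using degree_fejer[of m] m by linarith
  from legendre_expansion[OF this]
  have p_eq: "poly p t = (\<Sum>l\<le>L. (2 * real l + 1) * c l * poly (legendre l) t)" for t
    unfolding c_def by (metis (no_types, lifting) poly_smult poly_sum sum.cong)
  have form: "(\<Sum>i<N. \<Sum>j<N. v i * v j * poly p (inner (x i) (x j)))
      = (\<Sum>l\<le>L. (2 * real l + 1) * c l * legendre_form N x l v)"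
  proof -
    have "(\<Sum>i<N. \<Sum>j<N. v i * v j * poly p (inner (x i) (x j)))
      = (\<Sum>i<N. \<Sum>j<N. \<Sum>l\<le>L. (2 * real l + 1) * c l * (v i * v j * poly (legendre l) (inner (x i) (x j))))"
      unfolding p_eq by (simp add: sum_distrib_left mult_ac)
    also have "\<dots> = (\<Sum>i<N. \<Sum>l\<le>L. \<Sum>j<N. (2 * real l + 1) * c l * (v i * v j * poly (legendre l) (inner (x i) (x j))))"
      by (intro sum.cong refl sum.swap)
    also have "\<dots> = (\<Sum>l\<le>L. \<Sum>i<N. \<Sum>j<N. (2 * real l + 1) * c l * (v i * v j * poly (legendre l) (inner (x i) (x j))))"
      by (rule sum.swap)
    finally show ?thesis by (simp add: legendre_form_def sum_distrib_left)
  qed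
  have "(real m ^ 4 - 1600 / \<rho> ^ 4) * V \<le> (\<Sum>i<N. \<Sum>j<N. v i * v j * poly p (inner (x i) (x j)))"
    unfolding V_def
  proof (rule diagonally_dominant_form)
    show "poly p (inner (x i) (x i)) = real m ^ 4" if "i < N" for i
      using x[OF that] by (simp add: norm_eq_1 p_def fejer_at_1 flip: power_mult)
    show "poly p (inner (x i) (x j)) = poly p (inner (x j) (x i))" for i j
      by (simp add: inner_commute)
    show "0 \<le> poly p (inner (x i) (x j))" for i j by (simp add: p_def)
    fix i assume i: "i < N"
    have "(\<Sum>j\<in>{..<N} - {i}. poly p (inner (x i) (x j))) \<le> (\<Sum>j\<in>{..<N} - {i}. 4 / (1 - inner (x i) (x j))\<^sup>2)"
    proof (rule sum_mono)
      fix j assume j: "j \<in> {..<N} - {i}"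
      define t where "t = inner (x i) (x j)"
      have t: "-1 \<le> t" "t \<le> 1" using abs_inner_unit[of "x i" "x j"] x i j by (auto simp: t_def abs_le_iff)
      have "0 < norm (x i - x j)" using sep[of i j] i j \<rho> by auto
      then have "0 < (norm (x i - x j))\<^sup>2" by (rule zero_less_power)
      moreover have "(norm (x i - x j))\<^sup>2 = 2 - 2 * t"
        unfolding t_def using x i j by (intro norm_diff_unit) auto
      ultimately have "t < 1" by linarith
      have "(poly (fejer m) t * (1 - t))\<^sup>2 \<le> 2\<^sup>2"
        using fejer_bounds[OF t, of m] t by (intro power_mono) auto
      then show "poly p (inner (x i) (x j)) \<le> 4 / (1 - inner (x i) (x j))\<^sup>2"
        unfolding t_def[symmetric] p_def using \<open>t < 1\<close> by (simp add: power_mult_distrib pos_le_divide_eq)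
    qed
    also have "\<dots> \<le> 1600 / \<rho> ^ 4"
      by (rule separated_inverse_square_sum) (use x sep \<rho> i in auto)
    finally show "(\<Sum>j\<in>{..<N} - {i}. poly p (inner (x i) (x j))) \<le> 1600 / \<rho> ^ 4" .
  qed
  also have "\<dots> = c 0 * legendre_form N x 0 v + (\<Sum>l=1..L. (2 * real l + 1) * c l * legendre_form N x l v)"
    unfolding form by (simp add: sum.atMost_shift sum.atLeast1_atMost_eq)
  \<comment> \<open>The Legendre forms are nonnegative, so upper bounds for the coefficients
    suffice, whatever their signs.\<close>
  also have "c 0 * legendre_form N x 0 v \<le> 4 * (real m)\<^sup>2 * (real N * V)"
  proof -
    have "c 0 * legendre_form N x 0 v \<le> 4 * (real m)\<^sup>2 * legendre_form N x 0 v"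
      by (rule mult_right_mono[OF c legendre_form_bounds(1)[OF x]])
    also have "\<dots> \<le> 4 * (real m)\<^sup>2 * (real N * V)"
      unfolding V_def by (rule mult_left_mono[OF legendre_form_bounds(2)[OF x]]) auto
    finally show ?thesis .
  qed
  also have "(\<Sum>l=1..L. (2 * real l + 1) * c l * legendre_form N x l v)
      \<le> (\<Sum>l=1..L. 4 * (real m)\<^sup>2 * ((2 * real l + 1) * legendre_form N x l v))"
  proof (rule sum_mono)
    fix l
    have "0 \<le> (2 * real l + 1) * legendre_form N x l v"
      by (rule mult_nonneg_nonneg[OF _ legendre_form_bounds(1)[OF x]]) auto
    from mult_right_mono[OF c this]
    show "(2 * real l + 1) * c l * legendre_form N x l v \<le> 4 * (real m)\<^sup>2 * ((2 * real l + 1) * legendre_form N x l v)"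
      by (simp add: mult_ac)
  qed
  finally show ?thesis by (simp add: V_def sum_distrib_left algebra_simps)
qed

text \<open>The functionals are padded with zero rows to a square matrix. As counting starts at 0,
  the row number \<open>card F\<close> is already zero, so the determinant vanishes and a nonzero
  vector is mapped to zero.\<close>

lemma underdetermined_system:
  fixes F :: "(nat \<Rightarrow> real) set"
  assumes "finite F" "card F < N"
  obtains v where "v \<in> carrier_vec N" "v \<noteq> 0\<^sub>v N" "\<And>f. f \<in> F \<Longrightarrow> (\<Sum>i<N. vec_index v i * f i) = 0"
proof -
  obtain fs where fs: "set fs = F" "length fs = card F"
    using finite_distinct_list[OF assms(1)] distinct_card by metis
  define A where "A = Matrix.mat N N (\<lambda>(r, i). if r < length fs then (fs ! r) i else 0)"
  have A: "A \<in> carrier_mat N N" by (simp add: A_def)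
  have "A = mat_of_row_fun N N (\<lambda>r. if r = card F then 0\<^sub>v N else row A r)"
    using assms(2) fs(2) by (intro eq_matI) (auto simp: A_def)
  moreover have "Determinant.det (mat_of_row_fun N N (\<lambda>r. if r = card F then 0\<^sub>v N else row A r)) = 0"
    using A assms(2) by (intro det_row_0) auto
  ultimately have "Determinant.det A = 0" by simp
  then obtain v where v: "v \<in> carrier_vec N" "v \<noteq> 0\<^sub>v N" "A *\<^sub>v v = 0\<^sub>v N"
    using det_0_iff_vec_prod_zero[OF A] by blast
  show ?thesis
  proof (rule that[OF v(1,2)])
    fix f assume "f \<in> F"
    then obtain r where r: "r < length fs" "fs ! r = f" using fs by (metis in_set_conv_nth)
    then have "r < N" using fs assms by simp
    have "0 = vec_index (A *\<^sub>v v) r" using v(3) \<open>r < N\<close> by simp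
    also have "\<dots> = (\<Sum>i<N. f i * vec_index v i)"
      using \<open>r < N\<close> v(1) r by (simp add: A_def scalar_prod_def atLeast0LessThan)
    finally show "(\<Sum>i<N. vec_index v i * f i) = 0" by (simp add: mult.commute)
  qed
qed

text \<open>Since \<open>v\<close> is real, the conditions are counted over the reals: degree
  \<open>l\<close> imposes \<open>l + 1\<close> real parts and, order 0 being real, only
  \<open>l\<close> imaginary parts. The odd numbers \<open>2 l + 1\<close> for \<open>l < n\<close>
  add up to \<open>n^2\<close>.\<close>

lemma legendre_form_annihilator:
  assumes x: "\<And>i. i < N \<Longrightarrow> norm (x i) = 1" and n: "n\<^sup>2 < N"
  obtains v where "v \<in> carrier_vec N" "v \<noteq> 0\<^sub>v N" "\<And>l. l < n \<Longrightarrow> legendre_form N x l (vec_index v) = 0"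
proof -
  define G where "G l = (\<lambda>m i. Re (harmonic l m (x i))) ` {..l} \<union> (\<lambda>m i. Im (harmonic l m (x i))) ` {1..l}" for l
  have "card (\<Union>l<n. G l) \<le> (\<Sum>l<n. card (G l))" by (rule card_UN_le) simp
  also have "\<dots> \<le> (\<Sum>l<n. 2 * l + 1)"
  proof (rule sum_mono)
    fix l
    have "card (G l) \<le> card ((\<lambda>m i. Re (harmonic l m (x i))) ` {..l}) + card ((\<lambda>m i. Im (harmonic l m (x i))) ` {1..l})"
      unfolding G_def by (rule card_Un_le)
    also have "\<dots> \<le> card {..l} + card {1..l}" by (intro add_mono card_image_le) auto
    finally show "card (G l) \<le> 2 * l + 1" by simp
  qed
  also have "\<dots> = n\<^sup>2" by (induction n) (auto simp: power2_eq_square)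
  finally have "card (\<Union>l<n. G l) < N" using n by simp
  moreover have "finite (\<Union>l<n. G l)" by (auto simp: G_def)
  ultimately obtain v where v: "v \<in> carrier_vec N" "v \<noteq> 0\<^sub>v N"
    "\<And>f. f \<in> (\<Union>l<n. G l) \<Longrightarrow> (\<Sum>i<N. vec_index v i * f i) = 0"
    using underdetermined_system by metis
  show ?thesis
  proof (rule that[OF v(1,2)])
    fix l assume l: "l < n"
    have "(\<Sum>i<N. of_real (vec_index v i) * harmonic l m (x i)) = 0" if m: "m \<le> l" for m
    proof (rule complex_eqI)
      have "(\<lambda>i. Re (harmonic l m (x i))) \<in> (\<Union>l<n. G l)" using m l by (auto simp: G_def)
      from v(3)[OF this]
      show "Re (\<Sum>i<N. of_real (vec_index v i) * harmonic l m (x i)) = Re 0" by simp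
      show "Im (\<Sum>i<N. of_real (vec_index v i) * harmonic l m (x i)) = Im 0"
      proof (cases "m = 0")
        case True
        then show ?thesis by (simp add: harmonic_def sph_harm_def)
      next
        case False
        then have "(\<lambda>i. Im (harmonic l m (x i))) \<in> (\<Union>l<n. G l)" using m l by (force simp: G_def)
        from v(3)[OF this] show ?thesis by simp
      qed
    qed
    then show "legendre_form N x l (vec_index v) = 0"
      unfolding legendre_form_def by (subst legendre_quadratic_form) (auto simp: x)
  qed
qed

section \<open>Bounds for the condition number\<close>

text \<open>Strictness is the point: it is inherited by the covering bound and finally by
  \<open>n^2 < N\<close>, on which the choice of the annihilating vector rests. It comes from
  \<open>cos (x / 2) < 1\<close> in the double angle formula.\<close>

lemma sin_less_self:
  assumes "0 < x" "x \<le> (1::real)"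
  shows "sin x < x"
proof -
  have pos: "0 < sin (x / 4)" using assms by (intro sin_gt_zero_02) auto
  have "sin x = 2 * sin (x / 2) * cos (x / 2)" using sin_double[of "x / 2"] by simp
  also have "cos (x / 2) = 1 - 2 * (sin (x / 4))\<^sup>2" using cos_double_sin[of "x / 4"] by simp
  also have "2 * sin (x / 2) * (1 - 2 * (sin (x / 4))\<^sup>2) < 2 * sin (x / 2) * 1"
    using pos assms sin_gt_zero_02[of "x / 2"] by (intro mult_strict_left_mono) auto
  also have "\<dots> \<le> x" using sin_x_le_x[of "x / 2"] assms by simp
  finally show ?thesis .
qed

text \<open>By concavity the graph lies above the chord from 0 to \<open>pi / 2\<close>. This bounds
  the chordal separation below by a multiple of the geodesic one.\<close>

lemma jordan_sin_bound:
  assumes "0 \<le> x" "x \<le> pi / 2"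
  shows "2 / pi * x \<le> sin x"
proof -
  have "convex_on {0..pi} (\<lambda>x. - sin x)"
    by (rule f''_ge0_imp_convex[where f' = "\<lambda>x. - cos x" and f'' = sin])
      (auto intro!: derivative_eq_intros sin_ge_zero)
  from convex_onD[OF this, of "2 / pi * x" 0 "pi / 2"] show ?thesis
    using assms by (simp add: field_simps)
qed

text \<open>The chord over an arc \<open>d\<close> has length \<open>2 sin (d / 2)\<close>, which
  increases for \<open>d\<close> up to \<open>pi\<close>. The two points guarantee that the minimum
  is taken over a nonempty set.\<close>

lemma separated_chords:
  assumes "finite X" "X \<subseteq> sphere 0 1" "x \<in> X" "y \<in> X" "x \<noteq> y"
  shows "0 < separation_dist X" "separation_dist X \<le> pi"
    and "2 * sin (separation_dist X / 2) \<le> norm (x - y)"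
proof -
  let ?S = "{geo_dist x y | x y. x \<in> X \<and> y \<in> X \<and> x \<noteq> y}"
  have "?S \<subseteq> (\<lambda>(x, y). geo_dist x y) ` (X \<times> X)" by auto
  then have fin: "finite ?S" by (rule finite_subset) (use assms in auto)
  have ne: "?S \<noteq> {}" using assms by blast
  have chord: "0 < geo_dist x y \<and> geo_dist x y \<le> pi \<and> norm (x - y) = 2 * sin (geo_dist x y / 2)"
    if "x \<in> X" "y \<in> X" "x \<noteq> y" for x y
  proof -
    have n: "norm x = 1" "norm y = 1" using that assms(2) by auto
    define t where "t = inner x y"
    have t: "-1 \<le> t" "t \<le> 1" using abs_inner_unit[OF n] by (auto simp: t_def)
    have eq: "(norm (x - y))\<^sup>2 = 2 - 2 * t" using norm_diff_unit[OF n] by (simp add: t_def)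
    have "0 < (norm (x - y))\<^sup>2" using that by simp
    then have "t < 1" using eq by linarith
    then have "0 < arccos t" using t arccos_less_arccos[of t 1] by simp
    moreover have "arccos t \<le> pi" using t by (simp add: arccos_ubound)
    moreover have "norm (x - y) = 2 * sin (arccos t / 2)"
    proof (rule power2_eq_imp_eq)
      show "(norm (x - y))\<^sup>2 = (2 * sin (arccos t / 2))\<^sup>2"
        using eq cos_double_sin[of "arccos t / 2"] t by (simp add: power_mult_distrib)
      show "0 \<le> 2 * sin (arccos t / 2)"
        using calculation by (auto intro!: sin_ge_zero)
    qed simp
    ultimately show ?thesis by (simp add: geo_dist_def t_def)
  qed
  have "separation_dist X \<in> ?S" unfolding separation_dist_def by (rule Min_in[OF fin ne])
  then show q: "0 < separation_dist X" "separation_dist X \<le> pi" using chord by auto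
  have "separation_dist X \<le> geo_dist x y"
    unfolding separation_dist_def using assms by (intro Min_le[OF fin]) blast
  then have "sin (separation_dist X / 2) \<le> sin (geo_dist x y / 2)"
    using q chord[OF assms(3-5)] by (intro sin_monotone_2pi_le) auto
  then show "2 * sin (separation_dist X / 2) \<le> norm (x - y)"
    using chord[OF assms(3-5)] by simp
qed

lemma mesh_norm_covering:
  assumes "finite X" "X \<noteq> {}" "X \<subseteq> sphere 0 1" "norm x = 1" "mesh_norm X \<le> pi"
  shows "\<exists>y\<in>X. cos (mesh_norm X) \<le> inner x y"
proof -
  have range: "0 \<le> geo_dist x y \<and> geo_dist x y \<le> pi \<and> cos (geo_dist x y) = inner x y"
    if "norm x = 1" "y \<in> X" for x y
  proof -
    have "\<bar>inner x y\<bar> \<le> 1" using that assms(3) by (intro abs_inner_unit) auto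
    then show ?thesis by (auto simp: geo_dist_def abs_le_iff arccos_lbound arccos_ubound)
  qed
  have min: "(MIN y\<in>X. geo_dist x y) \<in> geo_dist x ` X" for x
    using assms(1,2) by (intro Min_in) auto
  have "(MIN y\<in>X. geo_dist x y) \<le> mesh_norm X"
    unfolding mesh_norm_def
  proof (rule cSUP_upper)
    show "bdd_above ((\<lambda>x. MIN y\<in>X. geo_dist x y) ` sphere 0 1)"
    proof (rule bdd_aboveI2)
      fix x :: "real^3" assume "x \<in> sphere 0 1"
      then show "(MIN y\<in>X. geo_dist x y) \<le> pi" using min[of x] range[of x] by auto
    qed
  qed (use assms in simp)
  moreover obtain y where y: "y \<in> X" "(MIN y\<in>X. geo_dist x y) = geo_dist x y"
    using min[of x] by auto
  ultimately have "geo_dist x y \<le> mesh_norm X" by simp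
  then have "cos (mesh_norm X) \<le> cos (geo_dist x y)"
    using range[OF assms(4) y(1)] assms(5) by (intro cos_monotone_0_pi_le) auto
  then show ?thesis using range[OF assms(4) y(1)] y by auto
qed

text \<open>The strict inequality \<open>1 - cos h = 2 sin^2 (h / 2) < h^2 / 2\<close> is inserted
  into the covering inequality with \<open>c = cos h\<close>.\<close>

lemma mesh_norm_card_bound:
  assumes "finite X" "X \<noteq> {}" "X \<subseteq> sphere 0 1" "0 < mesh_norm X" "mesh_norm X \<le> 2"
  shows "4 < real (card X) * (mesh_norm X)\<^sup>2"
proof -
  define h where "h = mesh_norm X"
  have h: "0 < h" "h \<le> 2" using assms by (auto simp: h_def)
  have s: "0 < sin (h / 2)" "sin (h / 2) < h / 2"
    using h by (intro sin_gt_zero_02 sin_less_self; simp)+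
  have cos: "cos h = 1 - 2 * (sin (h / 2))\<^sup>2" using cos_double_sin[of "h / 2"] by simp
  have sq: "(sin (h / 2))\<^sup>2 < (h / 2)\<^sup>2" using s by (intro power_strict_mono) auto
  have "h\<^sup>2 \<le> 2\<^sup>2" using h by (intro power_mono) auto
  then have c: "-1 < cos h" unfolding cos using sq by (simp add: power_divide)
  \<comment> \<open>If \<open>pi\<close> were at most 2, the sine bound at \<open>pi / 2\<close>
    would give \<open>1 < pi / 2\<close>, a contradiction. The result ensures
    \<open>h <= pi\<close>.\<close>
  have "2 < pi"
  proof (rule ccontr)
    assume "\<not> 2 < pi"
    then have "sin (pi / 2) < pi / 2" by (intro sin_less_self) auto
    with \<open>\<not> 2 < pi\<close> show False by simp
  qed
  then have "\<exists>y\<in>X. cos h \<le> inner x y" if "norm x = 1" for x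
    using mesh_norm_covering[OF assms(1-3) that] assms(5) by (simp add: h_def)
  then have "2 \<le> real (card X) * (1 - cos h)"
    using assms c by (intro covering_number[where y = "\<lambda>y. y"]) auto
  also have "\<dots> < real (card X) * (h\<^sup>2 / 2)"
    using sq assms by (intro mult_strict_left_mono) (auto simp: cos power_divide card_gt_0_iff)
  finally show ?thesis by (simp add: h_def)
qed

section \<open>Rayleigh quotients of the discrepancy matrix\<close>

lemma discrepancy_matrix_form:
  assumes "v \<in> carrier_vec N"
  shows "scalar_prod v (discrepancy_matrix s N x *\<^sub>v v) = kernel_form N x s (vec_index v)"
  using assms unfolding discrepancy_matrix_def kernel_form_def
  by (simp add: scalar_prod_def atLeast0LessThan sum_distrib_left mult_ac)

lemma scalar_prod_self: "v \<in> carrier_vec N \<Longrightarrow> scalar_prod v v = (\<Sum>i<N. (vec_index v i)\<^sup>2)"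
  for v :: "real Matrix.vec"
  by (simp add: scalar_prod_def atLeast0LessThan power2_eq_square)

text \<open>It suffices that \<open>V <= S\<close>: for \<open>l <= L\<close> the weight
  \<open>kernel_weight s l\<close> is at least \<open>2 l + 1\<close> times
  \<open>kernel_coeff s L / (4 * pi)\<close>, because the coefficients decrease in
  \<open>l\<close>.\<close>

lemma kernel_form_lower_bound:
  assumes s: "1 < s" and x: "\<And>i. i < N \<Longrightarrow> norm (x i) = 1"
    and q: "0 < q" "q \<le> pi"
    and sep: "\<And>i j. i < N \<Longrightarrow> j < N \<Longrightarrow> i \<noteq> j \<Longrightarrow> 2 * sin (q / 2) \<le> norm (x i - x j)"
    and N: "real N * q\<^sup>2 \<le> 4 * pi\<^sup>2" and L: "55 / q \<le> real L"
  shows "kernel_coeff s L / (4 * pi) * (\<Sum>i<N. (v i)\<^sup>2) \<le> kernel_form N x s v"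
proof -
  define V where "V = (\<Sum>i<N. (v i)\<^sup>2)"
  have "0 \<le> V" unfolding V_def by (intro sum_nonneg) auto
  define S where "S = (\<Sum>l=1..L. (2 * real l + 1) * legendre_form N x l v)"
  define \<rho> where "\<rho> = 2 * sin (q / 2)"
  have "2 / pi * (q / 2) \<le> sin (q / 2)" by (rule jordan_sin_bound) (use q in auto)
  then have \<rho>q: "2 * q / pi \<le> \<rho>" by (simp add: \<rho>_def)
  have "0 < 2 * q / pi" using q by simp
  then have \<rho>: "0 < \<rho>" "\<rho> \<le> 2" using \<rho>q by (auto simp: \<rho>_def)
  \<comment> \<open>The largest \<open>m\<close> with \<open>2 * m - 2 <= L\<close>; adding 1 after
    the division also yields \<open>L <= 2 * m\<close>.\<close>
  define m where "m = L div 2 + 1"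
  have m: "0 < m" "2 * m - 2 \<le> L" by (auto simp: m_def)
  have "L \<le> 2 * m" unfolding m_def by presburger
  then have "real L \<le> 2 * real m" by linarith
  with q have "real L * q \<le> 2 * real m * q" by simp
  moreover have "55 \<le> real L * q" using L q by (simp add: field_simps)
  ultimately have mq: "55 / 2 \<le> real m * q" by simp
  \<comment> \<open>After multiplication by \<open>q^4\<close> every term is estimated through
    \<open>u\<close> alone. The numbers 25600, 256 and 64 below come from the crude
    \<open>pi <= 4\<close>.\<close>
  define u where "u = (real m * q)\<^sup>2"
  have "(55 / 2)\<^sup>2 \<le> u" unfolding u_def using mq by (intro power_mono) auto
  then have u: "756 \<le> u" by (simp add: power2_eq_square)
  have p2: "pi\<^sup>2 \<le> 16" using power_mono[of pi 4 2] pi_less_4 by simp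
  have "1600 / \<rho> ^ 4 \<le> 1600 / (2 * q / pi) ^ 4"
    using \<rho>q \<open>0 < 2 * q / pi\<close> \<rho> by (intro divide_left_mono power_mono mult_pos_pos) auto
  also have "\<dots> = 100 * (pi\<^sup>2)\<^sup>2 / q ^ 4"
    by (simp add: power_divide power_mult_distrib flip: power_mult)
  finally have "1600 / \<rho> ^ 4 * q ^ 4 \<le> 100 * (pi\<^sup>2)\<^sup>2" using q by (simp add: field_simps)
  also have "\<dots> \<le> 100 * 16\<^sup>2" using p2 by (intro mult_left_mono power_mono) auto
  finally have 1: "1600 / \<rho> ^ 4 * q ^ 4 \<le> 25600" by simp
  have 2: "4 * (real m)\<^sup>2 * real N * q ^ 4 \<le> 256 * u"
  proof -
    have "4 * (real m)\<^sup>2 * real N * q ^ 4 = 4 * u * (real N * q\<^sup>2)"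
      by (simp add: u_def power_mult_distrib power4_eq_xxxx power2_eq_square)
    also have "\<dots> \<le> 4 * u * 64" using N p2 u by (intro mult_left_mono) auto
    finally show ?thesis by simp
  qed
  have 3: "4 * (real m)\<^sup>2 * q ^ 4 \<le> 64 * u"
  proof -
    have "q\<^sup>2 \<le> pi\<^sup>2" using q by (intro power_mono) auto
    have "4 * (real m)\<^sup>2 * q ^ 4 = 4 * u * q\<^sup>2"
      by (simp add: u_def power_mult_distrib power4_eq_xxxx power2_eq_square)
    also have "\<dots> \<le> 4 * u * 16" using \<open>q\<^sup>2 \<le> pi\<^sup>2\<close> p2 u by (intro mult_left_mono) auto
    finally show ?thesis by simp
  qed
  \<comment> \<open>Of \<open>u * u >= 756 * u\<close> the terms with \<open>u\<close> take 320, and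
    the remaining \<open>436 * u\<close> exceeds 25600.\<close>
  have 4: "25600 + 256 * u + 64 * u \<le> real m ^ 4 * q ^ 4"
  proof -
    have "real m ^ 4 * q ^ 4 = u * u"
      by (simp add: u_def power_mult_distrib power4_eq_xxxx power2_eq_square)
    moreover have "756 * u \<le> u * u" using u by (intro mult_right_mono) auto
    ultimately show ?thesis using u by linarith
  qed
  have "4 * (real m)\<^sup>2 * q ^ 4 \<le> (real m ^ 4 - 1600 / \<rho> ^ 4 - 4 * (real m)\<^sup>2 * real N) * q ^ 4"
    using 1 2 3 4 unfolding left_diff_distrib by linarith
  then have "4 * (real m)\<^sup>2 \<le> real m ^ 4 - 1600 / \<rho> ^ 4 - 4 * (real m)\<^sup>2 * real N"
    using q by (simp add: mult_le_cancel_right)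
  then have "4 * (real m)\<^sup>2 * V \<le> (real m ^ 4 - 1600 / \<rho> ^ 4 - 4 * (real m)\<^sup>2 * real N) * V"
    using \<open>0 \<le> V\<close> by (rule mult_right_mono)
  also have "\<dots> \<le> 4 * (real m)\<^sup>2 * S"
    unfolding V_def S_def by (rule legendre_form_lower_bound[OF x \<rho> _ m]) (use sep in \<open>auto simp: \<rho>_def\<close>)
  finally have "V \<le> S" using m by simp
  then have "kernel_coeff s L / (4 * pi) * V \<le> kernel_coeff s L / (4 * pi) * S"
    by (intro mult_left_mono) (auto simp: kernel_coeff_def)
  also have "\<dots> \<le> (\<Sum>l=1..L. kernel_weight s l * legendre_form N x l v)"
    unfolding S_def sum_distrib_left
  proof (rule sum_mono)
    fix l assume l: "l \<in> {1..L}"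
    have "kernel_coeff s L \<le> kernel_coeff s l"
      unfolding kernel_coeff_def using l s by (intro powr_mono2') auto
    then have "kernel_coeff s L / (4 * pi) * (2 * real l + 1) \<le> kernel_weight s l"
      using mult_left_mono[of _ _ "(2 * real l + 1) / (4 * pi)"]
      unfolding kernel_weight_def by (simp add: mult.commute)
    from mult_right_mono[OF this legendre_form_bounds(1)[of N x l v, OF x]]
    show "kernel_coeff s L / (4 * pi) * ((2 * real l + 1) * legendre_form N x l v)
        \<le> kernel_weight s l * legendre_form N x l v" by (simp add: mult_ac)
  qed
  also have "\<dots> \<le> kernel_form N x s v" by (rule kernel_form_partial_sum[OF s x])
  finally show ?thesis by (simp add: V_def)
qed

theorem theorem4p10:
  fixes N :: nat and x :: "nat \<Rightarrow> real^3" and X :: "(real^3) set"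
    and s h q :: real and L H :: int
  assumes "N \<ge> 2"
    and "bij_betw x {..<N} X"
    and "X \<subseteq> sphere 0 1"
    and "h = mesh_norm X"
    and "q = separation_dist X"
    and "0 < h" and "h \<le> 2"
    and "L = \<lceil>55 / q\<rceil>"
    and "H = \<lfloor>2 / h\<rfloor>"
    and "s > 1"
  shows "q ^ 3 * (s - 1) / (8 * pi\<^sup>2) * ((2 * real_of_int H + 1) / 9) powr s
           \<le> cond_number (discrepancy_matrix s N x)
       \<and> cond_number (discrepancy_matrix s N x)
           \<le> 8 * pi\<^sup>2 / (q\<^sup>2 * (s - 1)) * (2 * real_of_int L + 1) powr (2 * s)"
proof -
  note s = \<open>s > 1\<close>
  have fin: "finite X" and card: "card X = N"
    using assms(2) bij_betw_finite bij_betw_same_card by fastforce+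
  have inX: "x i \<in> X" if "i < N" for i using assms(2) that by (auto simp: bij_betw_def)
  have norm: "norm (x i) = 1" if "i < N" for i using inX[OF that] assms(3) by auto
  have distinct: "x i \<noteq> x j" if "i < N" "j < N" "i \<noteq> j" for i j
    using assms(2) that by (auto simp: bij_betw_def inj_on_def)
  have q: "0 < q" "q \<le> pi"
    using separated_chords(1,2)[OF fin assms(3) inX inX distinct, of 0 1] assms(1,5) by auto
  have sep: "2 * sin (q / 2) \<le> norm (x i - x j)" if "i < N" "j < N" "i \<noteq> j" for i j
    unfolding assms(5) using that by (intro separated_chords(3)[OF fin assms(3)] inX distinct)
  have jordan: "2 * q / pi \<le> 2 * sin (q / 2)"
    using jordan_sin_bound[of "q / 2"] q by simp
  have Nq: "real N * q\<^sup>2 \<le> 4 * pi\<^sup>2"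
  proof -
    have pos: "0 < 2 * q / pi" using q by simp
    have "real N * (2 * q / pi)\<^sup>2 \<le> real N * (2 * sin (q / 2))\<^sup>2"
      using jordan pos by (intro mult_left_mono power_mono) auto
    also have "\<dots> \<le> 16"
      using packing_number[of "{..<N}" x "2 * sin (q / 2)"] norm sep jordan pos by auto
    finally show ?thesis by (simp add: power_divide power_mult_distrib field_simps)
  qed
  \<comment> \<open>Since \<open>h <= 2\<close>, \<open>n\<close> is at least 1, as the tail
    estimate requires.\<close>
  define n where "n = nat H"
  have "1 \<le> 2 / h" using assms(6,7) by simp
  then have "1 \<le> H" using assms(9) by (simp add: le_floor_iff)
  then have n: "1 \<le> n" and H: "real_of_int H = real n" by (auto simp: n_def)
  have "real n \<le> 2 / h" using H assms(9) by (metis of_int_floor_le)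
  then have "real n * h \<le> 2" using assms(6) by (simp add: field_simps)
  then have "(real n * h)\<^sup>2 \<le> 2\<^sup>2" using assms(6) by (intro power_mono) auto
  also have "2\<^sup>2 < real N * h\<^sup>2"
    using mesh_norm_card_bound[OF fin _ assms(3)] assms(1,4,6,7) card by fastforce
  finally have "(real n)\<^sup>2 < real N" using assms(6) by (simp add: power_mult_distrib)
  then have nN: "n\<^sup>2 < N" by (metis of_nat_less_iff of_nat_power)
  define A where "A = discrepancy_matrix s N x"
  have A: "A \<in> carrier_mat N N" by (simp add: A_def discrepancy_matrix_def)
  have sym: "transpose_mat A = A"
    by (intro eq_matI) (auto simp: A_def discrepancy_matrix_def discrepancy_kernel_def inner_commute)
  define l where "l = nat L"
  have "0 < 55 / q" using q by simp
  then have "0 < L" using assms(8) by simp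
  then have L: "real_of_int L = real l" by (simp add: l_def)
  have Lq: "55 / q \<le> real l" using L assms(8) by (metis le_of_int_ceiling)
  define lo where "lo = kernel_coeff s l / (4 * pi)"
  define hi where "hi = real N / (4 * pi * (s - 1))"
  \<comment> \<open>The vector annihilates the degrees below \<open>n\<close>, so the tail starts at
    degree \<open>n\<close> itself.\<close>
  define small where "small = real N * real n powr (2 - 2 * s) / (4 * pi * (s - 1))"
  define large where "large = kernel_weight s 1"
  have lo: "0 < lo" by (simp add: lo_def kernel_coeff_def)
  have lo_form: "lo * scalar_prod v v \<le> scalar_prod v (A *\<^sub>v v)" if "v \<in> carrier_vec N" for v
    unfolding A_def discrepancy_matrix_form[OF that] scalar_prod_self[OF that] lo_def
    by (rule kernel_form_lower_bound[OF s norm q sep Nq Lq])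
  have hi_form: "scalar_prod v (A *\<^sub>v v) \<le> hi * scalar_prod v v" if "v \<in> carrier_vec N" for v
    unfolding A_def discrepancy_matrix_form[OF that] scalar_prod_self[OF that] hi_def
    using kernel_form_upper_bound[OF s norm, where k = 1 and v = "vec_index v"] by simp
  obtain v where v: "v \<in> carrier_vec N" "v \<noteq> 0\<^sub>v N" "\<And>l. l < n \<Longrightarrow> legendre_form N x l (vec_index v) = 0"
    using legendre_form_annihilator[of N x n, OF norm nN] by blast
  have small_form: "scalar_prod v (A *\<^sub>v v) \<le> small * scalar_prod v v"
    unfolding A_def discrepancy_matrix_form[OF v(1)] scalar_prod_self[OF v(1)] small_def
    by (rule kernel_form_upper_bound[OF s norm n v(3)])
  \<comment> \<open>A unit vector picks out a diagonal entry of the matrix. Its term of degree 1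
    alone is the lower bound \<open>large\<close>, since \<open>P_1(1) = 1\<close>.\<close>
  define w :: "real Matrix.vec" where "w = unit_vec N 0"
  have w: "w \<in> carrier_vec N" by (simp add: w_def)
  have w0: "vec_index w 0 = 1" using assms(1) by (simp add: w_def)
  have w_ne: "w \<noteq> 0\<^sub>v N" using w0 assms(1) by auto
  have large_form: "large * scalar_prod w w \<le> scalar_prod w (A *\<^sub>v w)"
  proof -
    have wi: "vec_index w i = (if i = 0 then 1 else 0)" if "i < N" for i using that by (simp add: w_def)
    have "legendre_form N x 1 (vec_index w) = (\<Sum>i<N. \<Sum>j<N. if i = 0 \<and> j = 0 then 1 else 0)"
      unfolding legendre_form_def
    proof (intro sum.cong refl)
      fix i j assume "i \<in> {..<N}" "j \<in> {..<N}"
      moreover have "inner (x 0) (x 0) = 1" using norm[of 0] assms(1) by (simp add: norm_eq_1)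
      ultimately show "vec_index w i * vec_index w j * poly (legendre 1) (inner (x i) (x j))
          = (if i = 0 \<and> j = 0 then 1 else 0)" by (auto simp: wi legendre_at_1)
    qed
    also have "\<dots> = (\<Sum>i<N. if i = 0 then (\<Sum>j<N. if j = 0 then 1 else 0) else 0)"
      by (intro sum.cong) auto
    also have "\<dots> = 1" using assms(1) by simp
    finally have "kernel_weight s 1 \<le> kernel_form N x s (vec_index w)"
      using kernel_form_partial_sum[of s N x "vec_index w" 1, OF s norm] by simp
    moreover have "scalar_prod w w = 1" using assms(1) by (simp add: w_def)
    ultimately show ?thesis unfolding large_def A_def discrepancy_matrix_form[OF w] by simp
  qed
  have "0 \<le> large" unfolding large_def using kernel_weight_pos by (rule less_imp_le)
  have "0 < N" using assms(1) by simp
  note bounds = cond_number_bounds[OF A sym \<open>0 < N\<close> lo lo_form hi_form v(1,2) small_form w w_ne large_form \<open>0 \<le> large\<close>]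
  have upper: "hi / lo \<le> 8 * pi\<^sup>2 / (q\<^sup>2 * (s - 1)) * (2 * real_of_int L + 1) powr (2 * s)"
  proof -
    have "hi / lo = real N / (s - 1) * (real l + 1/2) powr (2 * s)"
    proof -
      have lo_eq: "lo = inverse ((real l + 1/2) powr (2 * s)) / (4 * pi)"
        by (simp add: lo_def kernel_coeff_def powr_minus)
      have "a / (c * t) / (inverse P / c) = a / t * P" if "c \<noteq> 0" for a c t P :: real
        using that by (simp add: divide_inverse mult_ac)
      from this[of "4 * pi" "real N" "s - 1"] show ?thesis unfolding lo_eq hi_def by simp
    qed
    also have "\<dots> \<le> 8 * pi\<^sup>2 / (q\<^sup>2 * (s - 1)) * (2 * real_of_int L + 1) powr (2 * s)"
    proof (rule mult_mono)
      have "real N \<le> 8 * pi\<^sup>2 / q\<^sup>2" using Nq q by (simp add: field_simps) (smt (verit) zero_le_power2)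
      then have "real N / (s - 1) \<le> 8 * pi\<^sup>2 / q\<^sup>2 / (s - 1)" using s by (intro divide_right_mono) auto
      then show "real N / (s - 1) \<le> 8 * pi\<^sup>2 / (q\<^sup>2 * (s - 1))" by simp
      show "(real l + 1/2) powr (2 * s) \<le> (2 * real_of_int L + 1) powr (2 * s)"
        unfolding L using s by (intro powr_mono2) auto
    qed (use s q in auto)
    finally show ?thesis .
  qed
  have lower: "q ^ 3 * (s - 1) / (8 * pi\<^sup>2) * ((2 * real_of_int H + 1) / 9) powr s \<le> large / small"
  proof -
    \<comment> \<open>\<open>large / small\<close> produces the power of
      \<open>a = n^2 * (3/2) powr (- 2)\<close>, whereas the claim has the smaller base
      \<open>b\<close>.\<close>
    define a where "a = 4 * (real n)\<^sup>2 / 9"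
    define b where "b = (2 * real n + 1) / 9"
    have n0: "0 < real n" and n1: "1 \<le> real n" using n by auto
    have b: "0 < b" and ab: "b \<le> a"
    proof -
      show "0 < b" by (simp add: b_def)
      have "2 * real n + 1 \<le> 3 * real n" using n1 by simp
      also have "\<dots> \<le> 4 * (real n * real n)" using n1 mult_mono[of 1 "real n" "real n" "real n"] by simp
      finally show "b \<le> a" by (simp add: a_def b_def power2_eq_square)
    qed
    have large_eq: "large = 3 / (4 * pi) * (4 / 9) powr s"
    proof -
      have "(3 / 2 :: real) powr (- 2 * s) = ((3 / 2) powr (- 2)) powr s" by (simp add: powr_powr)
      also have "(3 / 2 :: real) powr (- 2) = 4 / 9" by (simp add: powr_minus power2_eq_square)
      finally show ?thesis by (simp add: large_def kernel_weight_def kernel_coeff_def)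
    qed
    have n_eq: "real n powr (2 - 2 * s) = (real n)\<^sup>2 / ((real n)\<^sup>2) powr s"
    proof -
      have "real n powr (2 * s) = ((real n)\<^sup>2) powr s"
        using n0 by (simp add: powr_powr[symmetric])
      moreover have "real n powr 2 = (real n)\<^sup>2" using n0 by simp
      ultimately show ?thesis using n0 by (simp only: powr_diff)
    qed
    have "large / small = 3 * (s - 1) / (real N * (real n)\<^sup>2) * ((4 / 9) powr s * ((real n)\<^sup>2) powr s)"
      unfolding large_eq small_def n_eq using s n0 \<open>0 < N\<close> by (simp add: field_simps)
    also have "(4 / 9) powr s * ((real n)\<^sup>2) powr s = a powr s"
      by (simp add: powr_mult[symmetric] a_def)
    finally have eq: "large / small = 3 * (s - 1) / (real N * (real n)\<^sup>2) * a powr s" .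
    \<comment> \<open>As \<open>a / b >= 1\<close> and \<open>s > 1\<close>, passing from base
      \<open>b\<close> to base \<open>a\<close> gains at least a factor \<open>a / b\<close>, which
      trades the denominator \<open>n^2\<close> for \<open>2 n + 1\<close>.\<close>
    have ratio: "4 * (real n)\<^sup>2 / (2 * real n + 1) * b powr s \<le> a powr s"
    proof -
      have "a / b \<le> (a / b) powr s"
        using powr_mono[of 1 s "a / b"] b ab s by simp
      also have "\<dots> = a powr s / b powr s" using b ab by (simp add: powr_divide)
      finally have "a / b * b powr s \<le> a powr s" using b by (simp add: field_simps)
      moreover have "a / b = 4 * (real n)\<^sup>2 / (2 * real n + 1)" by (simp add: a_def b_def)
      ultimately show ?thesis by simp
    qed
    \<comment> \<open>\<open>n^2 < N\<close> and the packing bound give \<open>q n <= 2 pi\<close>;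
      with \<open>q <= pi\<close> the factor \<open>q (2 n + 1)\<close> is at most
      \<open>5 pi < 24\<close>. The 24 matches the 12 in the final comparison, as
      \<open>4 * 24 = 8 * 12\<close>.\<close>
    have key: "q ^ 3 * real N * (2 * real n + 1) \<le> 96 * pi\<^sup>2"
    proof -
      have "(q * real n)\<^sup>2 \<le> (2 * pi)\<^sup>2"
      proof -
        have "(q * real n)\<^sup>2 \<le> real N * q\<^sup>2"
          using mult_right_mono[OF less_imp_le[OF \<open>(real n)\<^sup>2 < real N\<close>], of "q\<^sup>2"]
          by (simp add: power_mult_distrib mult.commute)
        also have "\<dots> \<le> (2 * pi)\<^sup>2" using Nq by (simp add: power_mult_distrib)
        finally show ?thesis .
      qed
      then have "q * real n \<le> 2 * pi" by (rule power2_le_imp_le) simp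
      then have "q * (2 * real n + 1) \<le> 24"
        using q pi_less_4 by (simp add: algebra_simps)
      then have "(real N * q\<^sup>2) * (q * (2 * real n + 1)) \<le> (4 * pi\<^sup>2) * 24"
        by (rule mult_mono[OF Nq]) (use q in auto)
      then show ?thesis by (simp add: power3_eq_cube power2_eq_square mult_ac)
    qed
    have "q ^ 3 * (s - 1) / (8 * pi\<^sup>2) * b powr s \<le> 12 * (s - 1) / (real N * (2 * real n + 1)) * b powr s"
    proof (rule mult_right_mono)
      have "q ^ 3 / (8 * pi\<^sup>2) \<le> 12 / (real N * (2 * real n + 1))"
      proof -
        define d where "d = real N * (2 * real n + 1)"
        have d: "0 < d" using \<open>0 < N\<close> n0 by (simp add: d_def)
        have "q ^ 3 * d \<le> 96 * pi\<^sup>2" using key by (simp only: d_def mult.assoc)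
        then have "q ^ 3 \<le> 96 * pi\<^sup>2 / d" using d by (simp add: pos_le_divide_eq)
        then have "q ^ 3 / (8 * pi\<^sup>2) \<le> 96 * pi\<^sup>2 / d / (8 * pi\<^sup>2)" by (rule divide_right_mono) simp
        also have "\<dots> = 12 / d" by simp
        finally show ?thesis unfolding d_def .
      qed
      then have "q ^ 3 / (8 * pi\<^sup>2) * (s - 1) \<le> 12 / (real N * (2 * real n + 1)) * (s - 1)"
        using s by (intro mult_right_mono) auto
      then show "q ^ 3 * (s - 1) / (8 * pi\<^sup>2) \<le> 12 * (s - 1) / (real N * (2 * real n + 1))" by simp
    qed simp
    also have "\<dots> = 3 * (s - 1) / (real N * (real n)\<^sup>2) * (4 * (real n)\<^sup>2 / (2 * real n + 1) * b powr s)"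
    proof -
      have "12 * t / (c * k) * B = 3 * t / (c * m) * (4 * m / k * B)"
        if "c \<noteq> 0" "k \<noteq> 0" "m \<noteq> 0" for t c k m B :: real
        using that by (simp add: field_simps)
      then show ?thesis using n0 \<open>0 < N\<close> by simp
    qed
    also have "\<dots> \<le> 3 * (s - 1) / (real N * (real n)\<^sup>2) * a powr s"
      using s by (intro mult_left_mono ratio) auto
    finally show ?thesis unfolding eq H b_def .
  qed
  show ?thesis
    using order_trans[OF lower bounds(1)] order_trans[OF bounds(2) upper] by (simp add: A_def)
qed

end
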